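(* There are four orbits of cominuscule parabolic sets of roots of $\mathfrak{g}=\mathfrak{osp}(2|2n)$ under the action of the Weyl group $W_{\mathfrak{sp}(2n)}$ of $\mathfrak{g}_{\bar0}$: those of $P_{\mathfrak{osp}(2|2n)}(0)$, $-P_{\mathfrak{osp}(2|2n)}(0)$, $P_{\mathfrak{osp}(2|2n)}(n)$ and $\overline P_{\mathfrak{osp}(2|2n)}(n)$. The corresponding Levi subalgebras $\mathfrak{l}$ and nilradicals $\mathfrak{n}^+$ (considered as $\mathfrak{l}$-modules) are given by $\mathfrak{l}\cong\mathfrak{sp}(2n)\oplus\mathbb{C}$, $\mathfrak{n}^+\cong V^{2n}$ in the first two cases, and $\mathfrak{l}\cong\mathfrak{sl}(1|n)$, $\mathfrak{n}^+\cong S^2V^{1|n}$ in the last two.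
   Context: $\mathfrak{g}_{\bar0}\cong\mathbb{C}\oplus\mathfrak{sp}(2n)$, $\mathfrak{h}$ is the standard Cartan subalgebra, and $\Delta=\Delta_{\bar0}\sqcup\Delta_{\bar1}$ with $\Delta_{\bar0}=\{\pm\delta_k\pm\delta_l,\ \pm2\delta_k\mid1\le k\ne l\le n\}$, $\Delta_{\bar1}=\{\pm\varepsilon_1\pm\delta_k\mid1\le k\le n\}$. The Weyl group acts by signed permutations of the $\delta_k$, fixing $\varepsilon_1$. A proper subset $P\subsetneq\Delta$ is parabolic if $\Delta=P\cup(-P)$ and ($\alpha,\beta\in P$, $\alpha+\beta\in\Delta$ imply $\alpha+\beta\in P$). Put $L=P\cap(-P)$, $N^+=P\setminus(-P)$, $\mathfrak{p}_P=\mathfrak{h}\oplus\bigoplus_{\alpha\in P}\mathfrak{g}^\alpha$, Levi subalgebra $\mathfrak{l}=\mathfrak{h}\oplus\bigoplus_{\alpha\in L}\mathfrak{g}^\alpha$, nilradical $\mathfrak{n}^+=\bigoplus_{\alpha\in N^+}\mathfrak{g}^\alpha$. $P$ is cominuscule if $\mathfrak{n}^+$ is abelian. Sets: $P_{\mathfrak{osp}(2|2n)}(0)=\Delta_{\bar0}\sqcup\{\varepsilon_1\pm\delta_k\mid k\ge1\}$; $P_{\mathfrak{osp}(2|2n)}(n)=L(n)\sqcup N^+(n)$ with $L(n)=\{\delta_k-\delta_l\mid k\neq l\}\sqcup\{\pm(\varepsilon_1-\delta_k)\mid k\ge1\}$, $N^+(n)=\{\delta_k+\delta_l,\ 2\delta_k\mid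 k\ne l\}\sqcup\{\varepsilon_1+\delta_k\mid k\ge1\}$; $\overline P_{\mathfrak{osp}(2|2n)}(n)=\overline L(n)\sqcup\overline N^+(n)$ with $\overline L(n)=\{\delta_k-\delta_l\mid k\neq l\}\sqcup\{\pm(\varepsilon_1+\delta_k)\mid k\ge1\}$, $\overline N^+(n)=\{\delta_k+\delta_l,\ 2\delta_k\mid k\ne l\}\sqcup\{-\varepsilon_1+\delta_k\mid k\ge1\}$. $V^{p}$ and $V^{p|q}$ are the standard representations of $\mathfrak{gl}(p)$ and $\mathfrak{gl}(p|q)$, with the same notation for restrictions to subalgebras; $S^2$ is the (super)symmetric square.
   Formalization: In the last two cases l has dimension (n+1)^2, so it is gl(1|n), with derived algebra sl(1|n), not sl(1|n) itself; by dimension n^+ is S^2 of the parity-shifted V^{1|n}. In the first two cases n^+ is odd, so it is V^{2n} with shifted parity. *)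

theory Defs
  imports "HOL-Analysis.Analysis"
begin

text \<open>
  Parities are booleans (\<open>True\<close> is odd), so the sum of two parities is \<open>d \<noteq> e\<close>. All dimensions
  are given by index types; the rank is \<open>n = CARD('n) \<ge> 1\<close>.
\<close>

section \<open>Lie superalgebras and their modules\<close>

text \<open>A superspace is the direct sum of its homogeneous parts \<open>homog V False\<close> and
  \<open>homog V True\<close>; both lie in an ambient type that supplies the addition.\<close>

record 'v superspace =
  scl :: "complex \<Rightarrow> 'v \<Rightarrow> 'v"
  homog :: "bool \<Rightarrow> 'v set"

record 'v lie_superalgebra = "'v superspace" +
  brk :: "'v \<Rightarrow> 'v \<Rightarrow> 'v"

record ('g, 'v) lie_module = "'v superspace" +
  act :: "'g \<Rightarrow> 'v \<Rightarrow> 'v"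

definition whole_space :: "('v::ab_group_add, 'z) superspace_scheme \<Rightarrow> 'v set" where
  "whole_space V = {x + y | x y. x \<in> homog V False \<and> y \<in> homog V True}"

definition superspace_iso ::
  "('v::ab_group_add, 'y) superspace_scheme \<Rightarrow> ('w::ab_group_add, 'z) superspace_scheme
    \<Rightarrow> ('v \<Rightarrow> 'w) \<Rightarrow> bool" where
  "superspace_iso V W f \<longleftrightarrow>
     (\<forall>x\<in>whole_space V. \<forall>y\<in>whole_space V. f (x + y) = f x + f y) \<and>
     (\<forall>c. \<forall>x\<in>whole_space V. f (scl V c x) = scl W c (f x)) \<and>
     bij_betw f (whole_space V) (whole_space W) \<and>
     (\<forall>d. f ` homog V d = homog W d)"

definition lie_superalgebra_iso ::
  "'v::ab_group_add lie_superalgebra \<Rightarrow> 'w::ab_group_add lie_superalgebra \<Rightarrow> ('v \<Rightarrow> 'w) \<Rightarrow> bool" where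
  "lie_superalgebra_iso A B \<phi> \<longleftrightarrow> superspace_iso A B \<phi> \<and>
     (\<forall>x\<in>whole_space A. \<forall>y\<in>whole_space A. \<phi> (brk A x y) = brk B (\<phi> x) (\<phi> y))"

text \<open>\<open>f\<close> is an even isomorphism from the \<open>A\<close>-module \<open>M\<close> to the pull-back of \<open>N\<close> along \<open>\<phi>\<close>.\<close>

definition lie_module_iso ::
  "'g::ab_group_add lie_superalgebra \<Rightarrow> ('g \<Rightarrow> 'h) \<Rightarrow> ('g, 'v::ab_group_add) lie_module
    \<Rightarrow> ('h, 'w::ab_group_add) lie_module \<Rightarrow> ('v \<Rightarrow> 'w) \<Rightarrow> bool" where
  "lie_module_iso A \<phi> M N f \<longleftrightarrow> superspace_iso M N f \<and>
     (\<forall>x\<in>whole_space A. \<forall>m\<in>whole_space M. f (act M x m) = act N (\<phi> x) (f m))"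

definition derived_subalgebra :: "'v::ab_group_add lie_superalgebra \<Rightarrow> 'v set" where
  "derived_subalgebra A =
     {(\<Sum>i<m. brk A (x i) (y i)) | (m::nat) x y. \<forall>i<m. x i \<in> whole_space A \<and> y i \<in> whole_space A}"

definition lie_direct_sum ::
  "'v::ab_group_add lie_superalgebra \<Rightarrow> 'w::ab_group_add lie_superalgebra
    \<Rightarrow> ('v \<times> 'w) lie_superalgebra" where
  "lie_direct_sum A B =
     \<lparr> scl = (\<lambda>c (x, y). (scl A c x, scl B c y)),
       homog = (\<lambda>d. homog A d \<times> homog B d),
       brk = (\<lambda>(x, y) (x', y'). (brk A x x', brk B y y')) \<rparr>"

definition abelian_line :: "complex lie_superalgebra" where
  "abelian_line = \<lparr> scl = (*), homog = (\<lambda>d. if d then {0} else UNIV), brk = (\<lambda>_ _. 0) \<rparr>"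

text \<open>The parity change \<open>\<Pi>M\<close>. The action is left as it is: the other convention,
  \<open>x \<cdot> \<Pi>m = (-1)\<^sup>|\<^sup>x\<^sup>| \<Pi>(x m)\<close>, gives an isomorphic module via \<open>m \<mapsto> (-1)\<^sup>|\<^sup>m\<^sup>| m\<close>.\<close>

definition parity_shift :: "('g, 'v) lie_module \<Rightarrow> ('g, 'v) lie_module" where
  "parity_shift M = M\<lparr> homog := (\<lambda>d. homog M (\<not> d)) \<rparr>"

section \<open>Supermatrices\<close>

text \<open>Matrices indexed by a type with parity function \<open>p\<close>. The matrix unit \<open>E\<^sub>i\<^sub>j\<close> has parity
  \<open>p i \<noteq> p j\<close>, which makes all the formulas below bilinear extensions of the usual sign rules.\<close>

definition koszul :: "bool \<Rightarrow> bool \<Rightarrow> complex" where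
  "koszul d e = (if d \<and> e then -1 else 1)"

definition scale_matrix :: "complex \<Rightarrow> complex^'i^'j \<Rightarrow> complex^'i^'j" where
  "scale_matrix c = map_matrix ((*) c)"

definition homog_matrices :: "('i \<Rightarrow> bool) \<Rightarrow> bool \<Rightarrow> (complex^'i^'i) set" where
  "homog_matrices p d = {X. \<forall>i j. X $ i $ j \<noteq> 0 \<longrightarrow> (p i \<noteq> p j) = d}"

definition super_bracket ::
  "('i::finite \<Rightarrow> bool) \<Rightarrow> complex^'i^'i \<Rightarrow> complex^'i^'i \<Rightarrow> complex^'i^'i" where
  "super_bracket p X Y = (\<chi> i j. \<Sum>k\<in>UNIV.
     X $ i $ k * Y $ k $ j - koszul (p i \<noteq> p k) (p k \<noteq> p j) * (Y $ i $ k * X $ k $ j))"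

definition matrix_superalgebra ::
  "('i::finite \<Rightarrow> bool) \<Rightarrow> (complex^'i^'i) set \<Rightarrow> (complex^'i^'i) lie_superalgebra" where
  "matrix_superalgebra p S =
     \<lparr> scl = scale_matrix, homog = (\<lambda>d. S \<inter> homog_matrices p d), brk = super_bracket p \<rparr>"

definition supertrace :: "('i::finite \<Rightarrow> bool) \<Rightarrow> complex^'i^'i \<Rightarrow> complex" where
  "supertrace p X = (\<Sum>i\<in>UNIV. koszul (p i) (p i) * X $ i $ i)"

text \<open>On \<open>\<complex>\<^sup>p\<^sup>|\<^sup>q\<close> the coordinates are indexed by \<open>'p + 'q\<close>, the first summand being even.
  The Levi subalgebras of \<open>P_n\<close> and \<open>Pbar_n\<close> below contain the whole Cartan subalgebra of rank
  \<open>n + 1\<close>, so they are \<open>gl(1|n)\<close>, of dimension \<open>(n+1)\<^sup>2\<close>; \<open>sl(1|n)\<close> is their derived algebra.\<close>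

definition par :: "'a + 'b \<Rightarrow> bool" where
  "par i = (\<not> isl i)"

definition gl_1n :: "(complex^(unit + 'n::finite)^(unit + 'n)) lie_superalgebra" where
  "gl_1n = matrix_superalgebra par UNIV"

definition sl_1n :: "(complex^(unit + 'n::finite)^(unit + 'n)) lie_superalgebra" where
  "sl_1n = matrix_superalgebra par {X. supertrace par X = 0}"

text \<open>The supersymmetric square of the standard module of the matrices with parity \<open>p\<close>, as the
  invariants of the super flip \<open>e\<^sub>i \<otimes> e\<^sub>j \<mapsto> (-1)\<^sup>|\<^sup>i\<^sup>|\<^sup>|\<^sup>j\<^sup>| e\<^sub>j \<otimes> e\<^sub>i\<close> in the tensor square. The
  entry \<open>T $ i $ j\<close> is the coefficient of \<open>e\<^sub>i \<otimes> e\<^sub>j\<close>, and the action is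
  \<open>X (e\<^sub>i \<otimes> e\<^sub>j) = X e\<^sub>i \<otimes> e\<^sub>j + (-1)\<^sup>|\<^sup>X\<^sup>|\<^sup>|\<^sup>i\<^sup>| e\<^sub>i \<otimes> X e\<^sub>j\<close>.\<close>

definition sym_square ::
  "('i::finite \<Rightarrow> bool) \<Rightarrow> (complex^'i^'i, complex^'i^'i) lie_module" where
  "sym_square p =
     \<lparr> scl = scale_matrix,
       homog = (\<lambda>d. {T. \<forall>i j. T $ i $ j = koszul (p i) (p j) * T $ j $ i} \<inter> homog_matrices p d),
       act = (\<lambda>X T. \<chi> i j. (\<Sum>k\<in>UNIV. X $ i $ k * T $ k $ j) +
                (\<Sum>k\<in>UNIV. koszul (p j \<noteq> p k) (p i) * X $ j $ k * T $ i $ k)) \<rparr>"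

text \<open>The \<open>gl(1|n)\<close>-module \<open>S\<^sup>2(\<Pi>V)\<close> for \<open>V = V\<^sup>1\<^sup>|\<^sup>n\<close>. Passing from \<open>V\<close> to \<open>\<Pi>V\<close> reverses the
  parities of the coordinates and changes neither the matrices nor their parities. Thus the
  supersymmetric square is ordinarily symmetric in the \<open>n\<close> directions and has dimension
  \<open>n(n+1)/2 | n\<close>.\<close>

definition S2_Pi_V1n ::
  "(complex^(unit + 'n::finite)^(unit + 'n), complex^(unit + 'n)^(unit + 'n)) lie_module" where
  "S2_Pi_V1n = sym_square (\<lambda>i. \<not> par i)"

section \<open>The Lie algebra \<open>sp(2n) \<oplus> \<complex>\<close> and the module \<open>V\<^sup>2\<^sup>n\<close>\<close>

text \<open>The standard basis of \<open>\<complex>\<^sup>2\<^sup>n\<close> is indexed by pairs \<open>(k, s)\<close>; the vector with index \<open>(k, s)\<close> has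
  weight \<open>\<delta>\<^sub>k\<close> if \<open>s = True\<close> and \<open>-\<delta>\<^sub>k\<close> if \<open>s = False\<close>.\<close>

fun symplectic_form :: "'n \<times> bool \<Rightarrow> 'n \<times> bool \<Rightarrow> complex" where
  "symplectic_form (k, s) (l, t) = (if k = l \<and> s \<noteq> t then (if s then 1 else -1) else 0)"

definition sp_2n :: "(complex^('n::finite \<times> bool)^('n \<times> bool)) lie_superalgebra" where
  "sp_2n = (let J = (\<chi> i j. symplectic_form i j) in
     matrix_superalgebra (\<lambda>_. False) {X. transpose X ** J + J ** X = 0})"

definition sp_2n_plus_C ::
  "((complex^('n::finite \<times> bool)^('n \<times> bool)) \<times> complex) lie_superalgebra" where
  "sp_2n_plus_C = lie_direct_sum sp_2n abelian_line"

text \<open>The restriction of the standard module of \<open>gl(2n)\<close>, with the line \<open>\<complex>\<close> acting by scalars.\<close>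

definition V_2n ::
  "((complex^('n::finite \<times> bool)^('n \<times> bool)) \<times> complex, complex^('n \<times> bool)) lie_module" where
  "V_2n =
     \<lparr> scl = (*s), homog = (\<lambda>d. if d then {0} else UNIV),
       act = (\<lambda>(X, c) v. X *v v + c *s v) \<rparr>"

section \<open>The Lie superalgebra \<open>osp(2|2n)\<close> and its roots\<close>

text \<open>In \<open>\<complex>\<^sup>2\<^sup>|\<^sup>2\<^sup>n\<close> the even basis vectors, indexed by \<open>Inl s\<close>, have weights \<open>\<epsilon>\<^sub>1\<close> (\<open>s = True\<close>) and
  \<open>-\<epsilon>\<^sub>1\<close> (\<open>s = False\<close>). They are isotropic and dual to each other.\<close>

type_synonym 'n osp_index = "bool + 'n \<times> bool"
type_synonym 'n osp_matrix = "complex^('n osp_index)^('n osp_index)"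

fun osp_form :: "'n osp_index \<Rightarrow> 'n osp_index \<Rightarrow> complex" where
  "osp_form (Inl s) (Inl t) = (if s \<noteq> t then 1 else 0)"
| "osp_form (Inr i) (Inr j) = symplectic_form i j"
| "osp_form _ _ = 0"

text \<open>\<open>(X e\<^sub>i, e\<^sub>j) + (-1)\<^sup>|\<^sup>X\<^sup>|\<^sup>|\<^sup>i\<^sup>| (e\<^sub>i, X e\<^sub>j) = 0\<close> for all basis vectors.\<close>

definition osp_homog :: "bool \<Rightarrow> ('n::finite osp_matrix) set" where
  "osp_homog d = {X \<in> homog_matrices par d. \<forall>i j.
     (\<Sum>k\<in>UNIV. X $ k $ i * osp_form k j) +
     koszul d (par i) * (\<Sum>k\<in>UNIV. osp_form i k * X $ k $ j) = 0}"

definition osp :: "('n::finite osp_matrix) set" where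
  "osp = {X + Y | X Y. X \<in> osp_homog False \<and> Y \<in> osp_homog True}"

definition cartan :: "('n::finite osp_matrix) set" where
  "cartan = {H \<in> osp. \<forall>i j. i \<noteq> j \<longrightarrow> H $ i $ j = 0}"

text \<open>\<open>(a, v)\<close> is the weight \<open>a \<epsilon>\<^sub>1 + \<Sum>\<^sub>k v\<^sub>k \<delta>\<^sub>k\<close>.\<close>

type_synonym 'n weight = "int \<times> (int^'n)"

definition eps :: "'n::finite weight" where
  "eps = (1, 0)"

definition delta :: "'n::finite \<Rightarrow> 'n weight" where
  "delta k = (0, axis k 1)"

definition weight_eval :: "'n::finite weight \<Rightarrow> 'n osp_matrix \<Rightarrow> complex" where
  "weight_eval \<alpha> H = of_int (fst \<alpha>) * H $ Inl True $ Inl True +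
     (\<Sum>k\<in>UNIV. of_int (snd \<alpha> $ k) * H $ Inr (k, True) $ Inr (k, True))"

definition root_space :: "'n::finite weight \<Rightarrow> ('n osp_matrix) set" where
  "root_space \<alpha> =
     {X \<in> osp. \<forall>H\<in>cartan. super_bracket par H X = scale_matrix (weight_eval \<alpha> H) X}"

definition even_roots :: "('n::finite weight) set" where
  "even_roots =
     {delta k + delta l | k l. k \<noteq> l} \<union> {delta k - delta l | k l. k \<noteq> l} \<union>
     {- delta k - delta l | k l. k \<noteq> l} \<union>
     {delta k + delta k | k. True} \<union> {- delta k - delta k | k. True}"

definition odd_roots :: "('n::finite weight) set" where
  "odd_roots =
     {eps + delta k | k. True} \<union> {eps - delta k | k. True} \<union>
     {- eps + delta k | k. True} \<union> {- eps - delta k | k. True}"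

definition roots :: "('n::finite weight) set" where
  "roots = even_roots \<union> odd_roots"

definition weyl_group :: "('n::finite weight \<Rightarrow> 'n weight) set" where
  "weyl_group =
     {(\<lambda>(a, v). (a, \<chi> k. s k * v $ \<sigma> k)) | s \<sigma>. (\<forall>k. s k = 1 \<or> s k = -1) \<and> bij \<sigma>}"

definition weyl_orbit :: "('n::finite weight) set \<Rightarrow> ('n weight) set set" where
  "weyl_orbit P = (\<lambda>w. w ` P) ` weyl_group"

section \<open>Parabolic sets of roots\<close>

definition parabolic :: "('n::finite weight) set \<Rightarrow> bool" where
  "parabolic P \<longleftrightarrow> P \<subset> roots \<and> roots = P \<union> uminus ` P \<and>
     (\<forall>\<alpha>\<in>P. \<forall>\<beta>\<in>P. \<alpha> + \<beta> \<in> roots \<longrightarrow> \<alpha> + \<beta> \<in> P)"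

definition root_space_sum :: "('n::finite weight) set \<Rightarrow> ('n osp_matrix) set" where
  "root_space_sum S = {(\<Sum>\<alpha>\<in>S. X \<alpha>) | X. \<forall>\<alpha>\<in>S. X \<alpha> \<in> root_space \<alpha>}"

definition levi :: "('n::finite weight) set \<Rightarrow> ('n osp_matrix) lie_superalgebra" where
  "levi P = matrix_superalgebra par
     {H + X | H X. H \<in> cartan \<and> X \<in> root_space_sum (P \<inter> uminus ` P)}"

definition nilradical :: "('n::finite weight) set \<Rightarrow> ('n osp_matrix) set" where
  "nilradical P = root_space_sum (P - uminus ` P)"

text \<open>The nilradical as a module over the Levi subalgebra, by the adjoint action.\<close>

definition nilradical_module ::
  "('n::finite weight) set \<Rightarrow> ('n osp_matrix, 'n osp_matrix) lie_module" where
  "nilradical_module P =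
     \<lparr> scl = scale_matrix, homog = (\<lambda>d. nilradical P \<inter> homog_matrices par d),
       act = super_bracket par \<rparr>"

definition cominuscule :: "('n::finite weight) set \<Rightarrow> bool" where
  "cominuscule P \<longleftrightarrow> parabolic P \<and>
     (\<forall>X\<in>nilradical P. \<forall>Y\<in>nilradical P. super_bracket par X Y = 0)"

definition P_zero :: "('n::finite weight) set" where
  "P_zero = even_roots \<union> {eps + delta k | k. True} \<union> {eps - delta k | k. True}"

definition P_n :: "('n::finite weight) set" where
  "P_n =
     ({delta k - delta l | k l. k \<noteq> l} \<union>
      {eps - delta k | k. True} \<union> {- (eps - delta k) | k. True}) \<union>
     ({delta k + delta l | k l. k \<noteq> l} \<union> {delta k + delta k | k. True} \<union>
      {eps + delta k | k. True})"

definition Pbar_n :: "('n::finite weight) set" where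
  "Pbar_n =
     ({delta k - delta l | k l. k \<noteq> l} \<union>
      {eps + delta k | k. True} \<union> {- (eps + delta k) | k. True}) \<union>
     ({delta k + delta l | k l. k \<noteq> l} \<union> {delta k + delta k | k. True} \<union>
      {- eps + delta k | k. True})"

end

theory Submission
  imports Defs
begin

text \<open>
  Everything is read off from matrix entries. Write \<open>i\<^sup>*\<close> (\<open>dual i\<close>) for the basis index of opposite
  weight. Membership in \<open>osp(2|2n)\<close> says that the entry at \<open>(j, i)\<close> is a fixed sign times the entry
  at \<open>(i\<^sup>*, j\<^sup>*)\<close>, and an entry at \<open>(i, j)\<close> has weight \<open>wt i - wt j\<close>. So root spaces, Levi
  subalgebras and nilradicals are the subspaces \<open>osp_on R\<close> of matrices with support in a relation
  \<open>R\<close>, and the roots are the differences \<open>wt i - wt j\<close> except \<open>0\<close> and \<open>\<plusminus>2\<epsilon>\<^sub>1\<close>.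

  The parabolic sets of the theorem are half-spaces \<open>{\<alpha>. h \<alpha> \<ge> 0}\<close> for additive functionals \<open>h\<close>.
  For \<open>\<plusminus>P_zero\<close> one takes \<open>h = \<plusminus>\<epsilon>\<^sub>1\<close> (\<open>P_pole\<close>). For \<open>P_n\<close>, \<open>Pbar_n\<close> and their images under the
  Weyl group, \<open>h\<close> is \<open>1\<close> on the weights of a choice of one index from each pair \<open>{i, i\<^sup>*}\<close>
  (\<open>P_half s\<close>, where \<open>s\<close> records the choice of signs). The chosen indices span a Lagrangian
  subspace \<open>W\<close>. The Weyl group fixes each \<open>P_pole b\<close> and changes the signs of the \<open>\<delta>\<^sub>k\<close> in \<open>s\<close>
  arbitrarily, but not that of \<open>\<epsilon>\<^sub>1\<close>; this gives the four orbits.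

  Conversely, let \<open>P\<close> be cominuscule with nilradical roots \<open>N\<close>. Brackets of root vectors whose
  weights add up to a root do not vanish (\<open>root_vectors_bracket\<close>), so a sum of two elements of \<open>N\<close>
  is never a root. Since \<open>(\<epsilon>\<^sub>1 + \<alpha>) - (\<epsilon>\<^sub>1 + \<beta>) = \<alpha> - \<beta>\<close>, the roots \<open>\<epsilon>\<^sub>1 \<plusminus> \<delta>\<^sub>k\<close> cannot
  meet both \<open>N\<close> and \<open>-N\<close>; up to the sign of \<open>\<epsilon>\<^sub>1\<close> they all lie in \<open>P\<close>. If all of them are in \<open>N\<close>,
  then \<open>P\<close> is a \<open>P_pole\<close>; if none is, then \<open>P\<close> contains all roots; otherwise exactly one of
  \<open>\<epsilon>\<^sub>1 + \<delta>\<^sub>k\<close> and \<open>\<epsilon>\<^sub>1 - \<delta>\<^sub>k\<close> is in \<open>N\<close> for each \<open>k\<close>, and these choices make \<open>P\<close> a \<open>P_half\<close>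
  (\<open>classification\<close>).

  For \<open>P_half s\<close> the Levi subalgebra consists of the matrices that preserve \<open>W\<close> and its dual
  complement; restriction to \<open>W\<close> identifies it with \<open>gl(1|n)\<close>. The nilradical consists of maps
  \<open>W\<^sup>* \<rightarrow> W\<close>, which become the symmetric tensors in \<open>S\<^sup>2(\<Pi>W)\<close> after a change of sign in each column.
  For \<open>P_pole b\<close> the Levi subalgebra is the even part, and an element of the nilradical is
  determined by its column of weight \<open>\<epsilon>\<^sub>1\<close> or \<open>-\<epsilon>\<^sub>1\<close>, a vector in \<open>\<complex>\<^sup>2\<^sup>n\<close>.
\<close>

section \<open>The weights of the standard module and the form\<close>

fun dual :: "'n osp_index \<Rightarrow> 'n osp_index" where
  "dual (Inl s) = Inl (\<not> s)"
| "dual (Inr (k, s)) = Inr (k, \<not> s)"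

fun wt :: "'n::finite osp_index \<Rightarrow> 'n weight" where
  "wt (Inl s) = (if s then eps else - eps)"
| "wt (Inr (k, s)) = (if s then delta k else - delta k)"

text \<open>The form pairs \<open>e\<^sub>i\<close> with \<open>e\<^bsub>i*\<^esub>\<close> only; this is the value \<open>(e\<^bsub>i*\<^esub>, e\<^sub>i)\<close>.\<close>

fun form_sign :: "'n osp_index \<Rightarrow> complex" where
  "form_sign (Inl s) = 1"
| "form_sign (Inr (k, s)) = (if s then -1 else 1)"

text \<open>The sign that relates the entries at \<open>(j, i)\<close> and \<open>(i\<^sup>*, j\<^sup>*)\<close> of a matrix in \<open>osp(2|2n)\<close>. It
  combines the sign rule for moving an entry of parity \<open>par i \<noteq> par j\<close> past \<open>e\<^sub>i\<close> with the two
  values of the form that are involved.\<close>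

definition swap_sign :: "'n osp_index \<Rightarrow> 'n osp_index \<Rightarrow> complex" where
  "swap_sign i j =
     - koszul (par i \<noteq> par j) (par i) * form_sign (dual i) * form_sign (dual j)"

lemma par_simps [simp]: "\<not> par (Inl x)" "par (Inr y)"
  by (auto simp: par_def)

lemma dual_dual [simp]: "dual (dual i) = i"
  by (cases i rule: dual.cases) auto

lemma dual_neq [simp]: "dual i \<noteq> i" "i \<noteq> dual i"
  by (cases i rule: dual.cases; auto)+

lemma dual_eq_iff [simp]: "dual i = dual j \<longleftrightarrow> i = j"
  by (metis dual_dual)

lemma dual_eq_flip: "dual i = j \<longleftrightarrow> i = dual j"
  by auto

lemma par_dual [simp]: "par (dual i) = par i"
  by (cases i rule: dual.cases) auto

lemma wt_dual [simp]: "wt (dual i) = - wt i"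
  by (cases i rule: dual.cases) auto

lemma form_sign_square [simp]: "form_sign i * form_sign i = 1"
  by (cases i rule: dual.cases) auto

lemma form_sign_dual: "form_sign (dual i) = (if par i then - form_sign i else form_sign i)"
  by (cases i rule: dual.cases) auto

lemma osp_form_eq: "osp_form i j = (if i = dual j then form_sign j else 0)"
  by (cases i rule: dual.cases; cases j rule: dual.cases) auto

lemma wt_inj [simp]: "wt i = wt j \<longleftrightarrow> i = j"
proof -
  have axis_eq: "axis k (1::int) = axis l 1 \<longleftrightarrow> k = l" for k l :: 'a
    by (auto simp: axis_eq_axis)
  have axis_neg: "axis k (1::int) \<noteq> - axis l 1" for k l :: 'a
    by (auto simp: vec_eq_iff axis_def intro!: exI[of _ k])
  have axis_neg': "- axis l 1 \<noteq> axis k (1::int)" for k l :: 'a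
    using axis_neg by metis
  show ?thesis
    by (cases i rule: dual.cases; cases j rule: dual.cases)
       (auto simp: eps_def delta_def axis_eq axis_neg axis_neg')
qed

lemma wt_neg_eq_iff [simp]: "- wt i = wt j \<longleftrightarrow> j = dual i" "wt i = - wt j \<longleftrightarrow> i = dual j"
  using wt_inj[of "dual i" j] wt_inj[of i "dual j"] by (simp_all only: wt_dual) auto

section \<open>Entrywise description of \<open>osp(2|2n)\<close>\<close>

text \<open>The values of the form are \<open>\<plusminus>1\<close>, so the defining equation of \<open>osp(2|2n)\<close> can be solved for one of
  its two entries.\<close>

lemma swap_sign_form:
  "X $ dual j $ i * form_sign j + koszul (par i \<noteq> par j) (par i) * (form_sign (dual i) * X $ dual i $ j) = 0
   \<longleftrightarrow> X $ dual j $ i = swap_sign i (dual j) * X $ dual i $ j"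
proof -
  have s: "form_sign j * form_sign j = 1" by simp
  define a b c k where "a = X $ dual j $ i" and "b = X $ dual i $ j" and "c = form_sign j"
    and "k = koszul (par i \<noteq> par j) (par i) * form_sign (dual i)"
  have "a * c + k * b = 0 \<longleftrightarrow> a = - k * c * b"
  proof
    assume "a * c + k * b = 0"
    then have "(a * c + k * b) * c = 0" by simp
    then have "a * (c * c) + k * c * b = 0" by (simp add: algebra_simps)
    then show "a = - k * c * b" using s by (simp add: c_def eq_neg_iff_add_eq_0)
  next
    assume "a = - k * c * b"
    then have "a * c + k * b = - k * b * (c * c) + k * b" by (simp add: algebra_simps)
    then show "a * c + k * b = 0" using s by (simp add: c_def)
  qed
  then show ?thesis
    by (simp add: a_def b_def c_def k_def swap_sign_def mult_ac)
qed

text \<open>For a homogeneous matrix the parity \<open>d\<close> in the defining equation can be replaced by the parity of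
  the entry, because entries of the other parity vanish. This makes the equation independent of \<open>d\<close>,
  hence valid for sums of an even and an odd part as well.\<close>

lemma osp_homog_iff:
  "X \<in> osp_homog d \<longleftrightarrow> X \<in> homog_matrices par d \<and>
     (\<forall>i j. X $ j $ i = swap_sign i j * X $ dual i $ dual j)"
proof -
  have sum1: "(\<Sum>k\<in>UNIV. X $ k $ i * osp_form k j) = X $ dual j $ i * form_sign j" for i j
    by (simp add: osp_form_eq if_distrib[of "\<lambda>x. _ * x"] sum.delta cong: if_cong)
  have sum2: "(\<Sum>k\<in>UNIV. osp_form i k * X $ k $ j) = form_sign (dual i) * X $ dual i $ j" for i j
  proof -
    have "osp_form i k * X $ k $ j = (if k = dual i then form_sign k * X $ k $ j else 0)" for k
      by (auto simp: osp_form_eq)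
    then show ?thesis by (simp add: sum.delta)
  qed
  have "X $ dual j $ i * form_sign j + koszul d (par i) * (form_sign (dual i) * X $ dual i $ j) = 0
     \<longleftrightarrow> X $ dual j $ i = swap_sign i (dual j) * X $ dual i $ j"
    if "X \<in> homog_matrices par d" for i j
  proof (cases "(par i \<noteq> par j) = d")
    case True
    then show ?thesis using swap_sign_form[of X j i] by simp
  next
    case False
    then have "X $ dual j $ i = 0" "X $ dual i $ j = 0"
      using that unfolding homog_matrices_def by fastforce+
    then show ?thesis by simp
  qed
  then have "X \<in> osp_homog d \<longleftrightarrow> X \<in> homog_matrices par d \<and>
     (\<forall>i j. X $ dual j $ i = swap_sign i (dual j) * X $ dual i $ j)"
    unfolding osp_homog_def by (auto simp: sum1 sum2)
  moreover have "(\<forall>i j. X $ dual j $ i = swap_sign i (dual j) * X $ dual i $ j)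
     \<longleftrightarrow> (\<forall>i j. X $ j $ i = swap_sign i j * X $ dual i $ dual j)"
    by (metis dual_dual)
  ultimately show ?thesis by simp
qed

text \<open>Homogeneous components, weight components and diagonal parts are all obtained by deleting entries.\<close>

definition mask :: "('i \<Rightarrow> 'i \<Rightarrow> bool) \<Rightarrow> complex^'i^'i \<Rightarrow> complex^'i^'i" where
  "mask Q X = (\<chi> i j. if Q i j then X $ i $ j else 0)"

lemma mask_nth [simp]: "mask Q X $ i $ j = (if Q i j then X $ i $ j else 0)"
  by (simp add: mask_def)

lemma supertranspose_add:
  assumes "X = A + B" "\<forall>i j. A $ j $ i = swap_sign i j * A $ dual i $ dual j"
    "\<forall>i j. B $ j $ i = swap_sign i j * B $ dual i $ dual j"
  shows "\<forall>i j. X $ j $ i = swap_sign i j * X $ dual i $ dual j"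
proof (intro allI)
  fix i j
  have "A $ j $ i + B $ j $ i = swap_sign i j * A $ dual i $ dual j + swap_sign i j * B $ dual i $ dual j"
    using assms(2,3) by (intro arg_cong2[where f = "(+)"]) blast+
  then show "X $ j $ i = swap_sign i j * X $ dual i $ dual j"
    by (simp only: assms(1) vector_add_component distrib_left)
qed

lemma osp_iff: "X \<in> osp \<longleftrightarrow> (\<forall>i j. X $ j $ i = swap_sign i j * X $ dual i $ dual j)"
proof
  assume "X \<in> osp"
  then obtain A B where "X = A + B" "A \<in> osp_homog False" "B \<in> osp_homog True"
    unfolding osp_def by blast
  then show "\<forall>i j. X $ j $ i = swap_sign i j * X $ dual i $ dual j"
    unfolding osp_homog_iff by (intro supertranspose_add[of X A B]) (elim conjE, assumption)+
next
  assume *: "\<forall>i j. X $ j $ i = swap_sign i j * X $ dual i $ dual j"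
  define A where "A d = mask (\<lambda>i j. (par i \<noteq> par j) = d) X" for d
  have "A d \<in> osp_homog d" for d
    unfolding osp_homog_iff
  proof (intro conjI allI)
    show "A d \<in> homog_matrices par d"
      by (auto simp: A_def homog_matrices_def)
    show "A d $ j $ i = swap_sign i j * A d $ dual i $ dual j" for i j
      using *[rule_format, of j i] by (auto simp: A_def)
  qed
  moreover have "X = A False + A True"
    by (simp add: A_def vec_eq_iff)
  ultimately show "X \<in> osp"
    unfolding osp_def by blast
qed

lemma ospD: "X \<in> osp \<Longrightarrow> X $ j $ i = swap_sign i j * X $ dual i $ dual j"
  unfolding osp_iff by blast

lemma swap_sign_simps:
  "swap_sign i i = -1"
  "swap_sign i (dual i) = (if par i then 1 else -1)"
  by (auto simp: swap_sign_def koszul_def form_sign_dual)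

text \<open>The relation between the entries at \<open>(j, i)\<close> and \<open>(i\<^sup>*, j\<^sup>*)\<close> is an involution; this is its
  consistency condition.\<close>

lemma swap_sign_cancel [simp]: "swap_sign i j * swap_sign (dual j) (dual i) = 1"
proof -
  have "swap_sign i j * swap_sign (dual j) (dual i) =
     koszul (par i \<noteq> par j) (par i) * koszul (par j \<noteq> par i) (par j) *
     (form_sign i * form_sign (dual i)) * (form_sign j * form_sign (dual j))"
    by (simp add: swap_sign_def mult_ac)
  then show ?thesis
    by (cases "par i"; cases "par j") (simp_all add: form_sign_dual koszul_def)
qed

lemma osp_diagonal: "X \<in> osp \<Longrightarrow> X $ dual i $ dual i = - X $ i $ i"
  using ospD[of X i i] by (simp add: swap_sign_simps)

lemma osp_isotropic_entry: "X \<in> osp \<Longrightarrow> \<not> par i \<Longrightarrow> X $ i $ dual i = 0"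
  using ospD[of X "i" "dual i"] swap_sign_simps(2)[of "dual i"] by simp

lemma osp_add: "X \<in> osp \<Longrightarrow> Y \<in> osp \<Longrightarrow> X + Y \<in> osp"
  unfolding osp_iff by (intro supertranspose_add[OF refl])

lemma scale_matrix_nth [simp]: "scale_matrix c X $ i $ j = c * X $ i $ j"
  by (simp add: scale_matrix_def map_matrix_def)

lemma super_bracket_nth:
  "super_bracket p X Y $ i $ j = (\<Sum>k\<in>UNIV.
     X $ i $ k * Y $ k $ j - koszul (p i \<noteq> p k) (p k \<noteq> p j) * (Y $ i $ k * X $ k $ j))"
  by (simp add: super_bracket_def)

lemma osp_mask:
  assumes "X \<in> osp" "\<And>i j. Q j i \<longleftrightarrow> Q (dual i) (dual j)"
  shows "mask Q X \<in> osp"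
  unfolding osp_iff
proof (intro allI)
  fix i j
  show "mask Q X $ j $ i = swap_sign i j * mask Q X $ dual i $ dual j"
    using ospD[OF assms(1), of j i] assms(2)[of j i] by simp
qed

lemma sum_dual: "(\<Sum>k\<in>UNIV. f (dual k)) = (\<Sum>k\<in>UNIV. f (k :: 'n::finite osp_index))"
  by (rule sum.reindex_bij_witness[of _ dual dual]) auto

text \<open>Passing from \<open>(j, i)\<close> to \<open>(i\<^sup>*, j\<^sup>*)\<close> reverses products. The two products in the bracket are
  exchanged, and the signs multiply to minus the Koszul sign of the bracket.\<close>

lemma osp_bracket:
  assumes "X \<in> osp" "Y \<in> osp"
  shows "super_bracket par X Y \<in> osp"
  unfolding osp_iff
proof (intro allI)
  fix i j :: "'a osp_index"
  have sgn: "swap_sign k j * swap_sign i k =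
      - swap_sign i j * koszul (par j \<noteq> par k) (par k \<noteq> par i)" for k
  proof -
    have "swap_sign k j * swap_sign i k =
      koszul (par k \<noteq> par j) (par k) * koszul (par i \<noteq> par k) (par i) *
      (form_sign (dual k) * form_sign (dual k)) * form_sign (dual i) * form_sign (dual j)"
      by (simp add: swap_sign_def mult_ac)
    also have "\<dots> = - swap_sign i j * koszul (par j \<noteq> par k) (par k \<noteq> par i)"
      unfolding form_sign_square swap_sign_def
      by (cases "par i"; cases "par j"; cases "par k") (simp_all add: koszul_def)
    finally show ?thesis .
  qed
  have kos: "koszul (par j \<noteq> par k) (par k \<noteq> par i) * koszul (par j \<noteq> par k) (par k \<noteq> par i) = 1"
    "koszul (par i \<noteq> par k) (par k \<noteq> par j) = koszul (par j \<noteq> par k) (par k \<noteq> par i)" for k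
    by (auto simp: koszul_def)
  have "X $ j $ k * Y $ k $ i - koszul (par j \<noteq> par k) (par k \<noteq> par i) * (Y $ j $ k * X $ k $ i) =
     swap_sign i j * (X $ dual i $ dual k * Y $ dual k $ dual j
       - koszul (par i \<noteq> par k) (par k \<noteq> par j) * (Y $ dual i $ dual k * X $ dual k $ dual j))" for k
  proof -
    define z where "z = koszul (par j \<noteq> par k) (par k \<noteq> par i)"
    have zz: "z * (z * w) = w" for w using kos(1)[of k] by (simp add: z_def mult.assoc[symmetric])
    have prod: "U $ j $ k * V $ k $ i = - swap_sign i j * z * (U $ dual k $ dual j * V $ dual i $ dual k)"
      if "U \<in> osp" "V \<in> osp" for U V
    proof -
      have "U $ j $ k * V $ k $ i = (swap_sign k j * U $ dual k $ dual j) * (swap_sign i k * V $ dual i $ dual k)"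
        by (intro arg_cong2[where f = "(*)"] ospD that)
      also have "\<dots> = (swap_sign k j * swap_sign i k) * (U $ dual k $ dual j * V $ dual i $ dual k)"
        by (simp only: mult_ac)
      finally show ?thesis unfolding sgn z_def by (simp only: mult_ac)
    qed
    show ?thesis
      unfolding prod[OF assms] prod[OF assms(2,1)] kos(2) z_def[symmetric]
      by (simp add: algebra_simps zz)
  qed
  then have "super_bracket par X Y $ j $ i = (\<Sum>k\<in>UNIV. swap_sign i j *
     (X $ dual i $ dual k * Y $ dual k $ dual j
       - koszul (par (dual i) \<noteq> par (dual k)) (par (dual k) \<noteq> par (dual j)) * (Y $ dual i $ dual k * X $ dual k $ dual j)))"
    by (simp add: super_bracket_nth)
  also have "\<dots> = swap_sign i j * super_bracket par X Y $ dual i $ dual j"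
    unfolding super_bracket_nth sum_distrib_left
    by (rule sum_dual[of "\<lambda>k. swap_sign i j *
     (X $ dual i $ k * Y $ k $ dual j
       - koszul (par (dual i) \<noteq> par k) (par k \<noteq> par (dual j)) * (Y $ dual i $ k * X $ k $ dual j))"])
  finally show "super_bracket par X Y $ j $ i = swap_sign i j * super_bracket par X Y $ dual i $ dual j" .
qed

section \<open>Root spaces, Levi subalgebras and nilradicals as supports\<close>

definition osp_on :: "('n osp_index \<Rightarrow> 'n osp_index \<Rightarrow> bool) \<Rightarrow> ('n::finite osp_matrix) set" where
  "osp_on R = {X \<in> osp. \<forall>i j. X $ i $ j \<noteq> 0 \<longrightarrow> R i j}"

lemma osp_onI: "X \<in> osp \<Longrightarrow> (\<And>i j. X $ i $ j \<noteq> 0 \<Longrightarrow> R i j) \<Longrightarrow> X \<in> osp_on R"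
  by (simp add: osp_on_def)

lemma osp_onD: "X \<in> osp_on R \<Longrightarrow> X \<in> osp" "X \<in> osp_on R \<Longrightarrow> \<not> R i j \<Longrightarrow> X $ i $ j = 0"
  by (auto simp: osp_on_def)

lemma osp_on_add: "X \<in> osp_on R \<Longrightarrow> Y \<in> osp_on R \<Longrightarrow> X + Y \<in> osp_on R"
  unfolding osp_on_def by (auto intro: osp_add) force

lemma zero_osp_on: "0 \<in> osp_on R"
  by (simp add: osp_on_def osp_iff)

lemma osp_on_sum: "(\<And>a. a \<in> S \<Longrightarrow> X a \<in> osp_on R) \<Longrightarrow> sum X S \<in> osp_on R"
  by (induction S rule: infinite_finite_induct) (auto intro: osp_on_add zero_osp_on)

lemma osp_on_mono: "(\<And>i j. R i j \<Longrightarrow> R' i j) \<Longrightarrow> osp_on R \<subseteq> osp_on R'"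
  by (auto simp: osp_on_def)

lemma cartan_eq: "cartan = osp_on (=)"
  by (auto simp: cartan_def osp_on_def)

text \<open>The basis of the Cartan subalgebra dual to the weights \<open>\<epsilon>\<^sub>1\<close> and \<open>\<delta>\<^sub>k\<close>, up to sign.\<close>

definition cartan_basis :: "'n::finite osp_index \<Rightarrow> 'n osp_matrix" where
  "cartan_basis i = (\<chi> k l. if k = l then (if k = i then 1 else if k = dual i then -1 else 0) else 0)"

lemma cartan_basis_nth [simp]: "cartan_basis i $ k $ l =
  (if k = l then (if k = i then 1 else if k = dual i then -1 else 0) else 0)"
  by (simp add: cartan_basis_def)

lemma cartan_basis: "cartan_basis i \<in> cartan"
  unfolding cartan_eq
proof (rule osp_onI)
  show "cartan_basis i \<in> osp"
    unfolding osp_iff by (auto simp: swap_sign_simps)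
qed (auto split: if_splits)

lemma weight_eval_wt:
  assumes "H \<in> cartan"
  shows "weight_eval (wt i) H = H $ i $ i"
proof -
  have neg: "H $ dual i $ dual i = - H $ i $ i" for i
    using assms by (intro osp_diagonal) (simp add: cartan_def)
  have *: "(\<Sum>k\<in>UNIV. of_int (axis l 1 $ k) * f k) = f l" for f :: "'a \<Rightarrow> complex" and l
  proof -
    have "of_int (axis l 1 $ k) * f k = (if k = l then f k else 0)" for k
      by (simp add: axis_def)
    then show ?thesis by simp
  qed
  have **: "(\<Sum>k\<in>UNIV. of_int ((- axis l 1) $ k) * f k) = - f l" for f :: "'a \<Rightarrow> complex" and l
    using *[of l f] by (simp add: sum_negf)
  show ?thesis
    using neg[of "Inl True"] neg[of "Inr (k, True)" for k]
    by (cases i rule: dual.cases) (auto simp: weight_eval_def eps_def delta_def * ** simp del: vector_uminus_component)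
qed

lemma weight_eval_diff: "weight_eval (\<alpha> - \<beta>) H = weight_eval \<alpha> H - weight_eval \<beta> H"
  by (simp add: weight_eval_def sum_subtractf algebra_simps)

text \<open>The diagonal matrices above read off the single coordinates of a weight.\<close>

lemma weight_eval_inj:
  assumes "\<forall>H\<in>cartan. weight_eval \<alpha> H = weight_eval \<beta> H"
  shows "\<alpha> = \<beta>"
proof -
  have "weight_eval \<alpha> (cartan_basis (Inl True)) = of_int (fst \<alpha>)" for \<alpha> :: "'a weight"
    by (simp add: weight_eval_def)
  moreover have "weight_eval \<alpha> (cartan_basis (Inr (k, True))) = of_int (snd \<alpha> $ k)" for \<alpha> :: "'a weight" and k
    by (simp add: weight_eval_def if_distrib[of "\<lambda>x. _ * x"] sum.delta cong: if_cong)
  ultimately show ?thesis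
    using assms cartan_basis by (metis of_int_eq_iff prod_eq_iff vec_eq_iff)
qed

lemma cartan_bracket:
  assumes "H \<in> cartan"
  shows "super_bracket par H X $ i $ j = weight_eval (wt i - wt j) H * X $ i $ j"
proof -
  have H: "H $ k $ l = (if k = l then H $ l $ l else 0)" for k l
    using assms by (auto simp: cartan_def)
  have "H $ i $ k * X $ k $ j - koszul (par i \<noteq> par k) (par k \<noteq> par j) * (X $ i $ k * H $ k $ j)
    = (if k = i then H $ i $ i * X $ i $ j else 0) - (if k = j then H $ j $ j * X $ i $ j else 0)" for k
    by (subst (1 2) H) (auto simp: koszul_def)
  then show ?thesis
    using assms by (simp add: super_bracket_nth sum_subtractf weight_eval_diff weight_eval_wt left_diff_distrib)
qed

text \<open>An element of the Cartan subalgebra scales the entry at \<open>(i, j)\<close> by \<open>wt i - wt j\<close>, and distinct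
  weights differ on some element.\<close>

lemma root_space_eq: "root_space \<alpha> = osp_on (\<lambda>i j. wt i - wt j = \<alpha>)"
proof -
  have "(\<forall>H\<in>cartan. super_bracket par H X = scale_matrix (weight_eval \<alpha> H) X)
    \<longleftrightarrow> (\<forall>i j. X $ i $ j \<noteq> 0 \<longrightarrow> wt i - wt j = \<alpha>)" (is "?L \<longleftrightarrow> ?R") for X
  proof
    assume ?L
    then have "\<forall>H\<in>cartan. weight_eval (wt i - wt j) H * X $ i $ j = weight_eval \<alpha> H * X $ i $ j" for i j
      using cartan_bracket[of _ X i j] by (metis scale_matrix_nth)
    then have "\<forall>H\<in>cartan. weight_eval (wt i - wt j) H = weight_eval \<alpha> H" if "X $ i $ j \<noteq> 0" for i j
      using that by (metis mult_right_cancel)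
    then show ?R by (blast intro: weight_eval_inj)
  next
    assume ?R
    then show ?L by (auto simp: vec_eq_iff cartan_bracket)
  qed
  then show ?thesis by (simp add: root_space_def osp_on_def)
qed

lemma root_wt_sum:
  assumes "\<alpha> \<in> roots"
  shows "\<exists>i j. \<alpha> = wt i + wt j"
proof -
  have "\<exists>i j. delta k + delta l = wt i + wt j" "\<exists>i j. delta k - delta l = wt i + wt j"
    "\<exists>i j. - delta k - delta l = wt i + wt j" for k l :: 'a
    by (rule exI[of _ "Inr (k, True)"] exI[of _ "Inr (k, False)"],
        rule exI[of _ "Inr (l, True)"] exI[of _ "Inr (l, False)"], simp)+
  moreover have "\<exists>i j. eps + delta k = wt i + wt j" "\<exists>i j. eps - delta k = wt i + wt j"
    "\<exists>i j. - eps + delta k = wt i + wt j" "\<exists>i j. - eps - delta k = wt i + wt j" for k :: 'a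
    by (rule exI[of _ "Inl True"] exI[of _ "Inl False"],
        rule exI[of _ "Inr (k, True)"] exI[of _ "Inr (k, False)"], simp)+
  ultimately show ?thesis
    using assms unfolding roots_def even_roots_def odd_roots_def by (elim UnE CollectE exE conjE) metis+
qed

lemma finite_roots: "finite (roots :: 'n::finite weight set)"
proof -
  have "(roots :: 'n weight set) \<subseteq> range (\<lambda>(i, j). wt i + wt j)"
    using root_wt_sum by fastforce
  then show ?thesis by (rule finite_subset) simp
qed

text \<open>A matrix is the sum of its weight components, and each of them stays in \<open>osp(2|2n)\<close> because \<open>(j, i)\<close>
  and \<open>(i\<^sup>*, j\<^sup>*)\<close> have the same weight.\<close>

lemma root_space_sum_eq:
  assumes "finite S"
  shows "root_space_sum S = osp_on (\<lambda>i j. wt i - wt j \<in> S)"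
proof (intro equalityI subsetI)
  fix X :: "'a osp_matrix" assume "X \<in> root_space_sum S"
  then obtain Y where "X = (\<Sum>\<alpha>\<in>S. Y \<alpha>)" "\<forall>\<alpha>\<in>S. Y \<alpha> \<in> root_space \<alpha>"
    by (auto simp: root_space_sum_def)
  then show "X \<in> osp_on (\<lambda>i j. wt i - wt j \<in> S)"
    unfolding root_space_eq
    using osp_on_mono[of "\<lambda>i j. wt i - wt j = \<alpha>" "\<lambda>i j. wt i - wt j \<in> S" for \<alpha>]
    by (auto intro!: osp_on_sum)
next
  fix X :: "'a osp_matrix" assume X: "X \<in> osp_on (\<lambda>i j. wt i - wt j \<in> S)"
  define Y where "Y \<alpha> = mask (\<lambda>i j. wt i - wt j = \<alpha>) X" for \<alpha>
  have "Y \<alpha> \<in> root_space \<alpha>" for \<alpha>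
    unfolding root_space_eq Y_def
    by (rule osp_onI, rule osp_mask) (use X in \<open>auto simp: osp_on_def split: if_splits\<close>)
  moreover have "X = (\<Sum>\<alpha>\<in>S. Y \<alpha>)"
    using X assms by (auto simp: vec_eq_iff Y_def sum.delta dest: osp_onD(2))
  ultimately show "X \<in> root_space_sum S"
    by (auto simp: root_space_sum_def)
qed

lemma wt_add_mem_roots:
  "wt i + wt j \<in> roots \<longleftrightarrow> j \<noteq> dual i \<and> (par i \<or> par j)" (is "?L \<longleftrightarrow> ?R")
proof
  assume ?R
  have odd: "- eps + - delta k \<in> roots" "eps + - delta k \<in> roots" "- eps + delta k \<in> roots" "eps + delta k \<in> roots"
    "- delta k + - eps \<in> roots" "- delta k + eps \<in> roots" "delta k + - eps \<in> roots" "delta k + eps \<in> roots" for k :: 'a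
    unfolding roots_def odd_roots_def by (auto simp: add.commute[of "delta k"] add.commute[of "- delta k"])
  have even: "delta k + delta l \<in> roots" "- delta k + - delta l \<in> roots" for k l :: 'a
    unfolding roots_def even_roots_def by (cases "k = l"; auto)+
  have even': "delta k + - delta l \<in> roots" "- delta l + delta k \<in> roots" if "k \<noteq> l" for k l :: 'a
    unfolding roots_def even_roots_def using that by (auto simp: add.commute[of "- delta l"])
  show ?L
    using \<open>?R\<close> odd even even'
    by (cases i rule: dual.cases; cases j rule: dual.cases) auto
next
  assume ?L
  have ne: "j \<noteq> dual i"
  proof
    assume "j = dual i"
    then have "0 \<in> (roots :: 'a weight set)" using \<open>?L\<close> by simp
    then show False
      by (auto simp: roots_def even_roots_def odd_roots_def eps_def delta_def zero_prod_def vec_eq_iff axis_def split: if_splits)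
  qed
  have fst: "\<bar>fst \<alpha>\<bar> \<le> 1" if "\<alpha> \<in> roots" for \<alpha> :: "'a weight"
    using that by (auto simp: roots_def even_roots_def odd_roots_def eps_def delta_def)
  have "par i \<or> par j"
    using fst[OF \<open>?L\<close>] ne
    by (cases i rule: dual.cases; cases j rule: dual.cases) (auto simp: eps_def split: if_splits)
  with ne show ?R by simp
qed

lemma wt_diff_mem_roots: "wt i - wt j \<in> roots \<longleftrightarrow> i \<noteq> j \<and> (par i \<or> par j)"
  using wt_add_mem_roots[of i "dual j"] by auto

lemma rootsE:
  assumes "\<alpha> \<in> roots"
  obtains i j where "\<alpha> = wt i - wt j" "i \<noteq> j" "par i \<or> par j"
proof -
  obtain i j where "\<alpha> = wt i - wt (dual j)"
    using root_wt_sum[OF assms] by auto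
  then show ?thesis using assms that wt_diff_mem_roots by blast
qed

lemma uminus_mem_roots: "\<alpha> \<in> roots \<Longrightarrow> - \<alpha> \<in> roots"
  by (erule rootsE) (auto simp: wt_diff_mem_roots)

lemma uminus_mem_roots_iff [simp]: "- \<alpha> \<in> roots \<longleftrightarrow> \<alpha> \<in> roots"
  using uminus_mem_roots[of \<alpha>] uminus_mem_roots[of "- \<alpha>"] by auto

text \<open>The only differences of distinct weights that are not roots are \<open>\<plusminus>2\<epsilon>\<^sub>1\<close>; the entries of these
  weights are equal to their own negatives.\<close>

lemma osp_entry_root:
  assumes "X \<in> osp" "X $ i $ j \<noteq> 0" "i \<noteq> j"
  shows "wt i - wt j \<in> roots"
proof (rule ccontr)
  assume "\<not> ?thesis"
  then have "\<not> par i" "\<not> par j" using assms(3) by (auto simp: wt_diff_mem_roots)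
  then have "j = dual i" using assms(3) by (cases i; cases j) auto
  then show False using osp_isotropic_entry[OF assms(1) \<open>\<not> par i\<close>] assms(2) by simp
qed

section \<open>Parabolic sets defined by a functional\<close>

definition halfspace_roots :: "('n::finite weight \<Rightarrow> int) \<Rightarrow> 'n weight set" where
  "halfspace_roots h = {\<alpha> \<in> roots. 0 \<le> h \<alpha>}"

definition levi_carrier :: "('n::finite weight) set \<Rightarrow> ('n osp_matrix) set" where
  "levi_carrier P = {H + X | H X. H \<in> cartan \<and> X \<in> root_space_sum (P \<inter> uminus ` P)}"

lemma levi_eq: "levi P = matrix_superalgebra par (levi_carrier P)"
  by (simp add: levi_def levi_carrier_def)

lemma levi_carrier_eq:
  assumes "finite P"
  shows "levi_carrier P = osp_on (\<lambda>i j. i = j \<or> wt i - wt j \<in> P \<inter> uminus ` P)" (is "_ = osp_on ?R")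
proof -
  have "finite (P \<inter> uminus ` P)" using assms by simp
  note rs = root_space_sum_eq[OF this]
  show ?thesis
  proof (intro equalityI subsetI)
    fix X :: "'a osp_matrix" assume "X \<in> levi_carrier P"
    then show "X \<in> osp_on ?R"
      unfolding levi_carrier_def rs cartan_eq
      using osp_on_mono[of "(=)" ?R] osp_on_mono[of "\<lambda>i j. wt i - wt j \<in> P \<inter> uminus ` P" ?R]
      by (auto intro!: osp_on_add)
  next
    fix X :: "'a osp_matrix" assume X: "X \<in> osp_on ?R"
    have "mask (=) X \<in> cartan"
      unfolding cartan_eq by (rule osp_onI, rule osp_mask) (use X in \<open>auto simp: osp_on_def split: if_splits\<close>)
    moreover have "mask (\<noteq>) X \<in> root_space_sum (P \<inter> uminus ` P)"
      unfolding rs by (rule osp_onI, rule osp_mask) (use X in \<open>auto simp: osp_on_def split: if_splits\<close>)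
    moreover have "X = mask (=) X + mask (\<noteq>) X"
      by (simp add: vec_eq_iff)
    ultimately show "X \<in> levi_carrier P"
      unfolding levi_carrier_def by blast
  qed
qed

lemma finite_halfspace [simp]: "finite (halfspace_roots h)"
  by (rule finite_subset[OF _ finite_roots]) (auto simp: halfspace_roots_def)

lemma mem_uminus_image: "\<alpha> \<in> uminus ` P \<longleftrightarrow> - \<alpha> \<in> (P :: 'a::group_add set)"
  by (metis add.inverse_inverse image_iff)

context
  fixes h :: "'n::finite weight \<Rightarrow> int"
  assumes h_add: "\<And>\<alpha> \<beta>. h (\<alpha> + \<beta>) = h \<alpha> + h \<beta>"
begin

lemma additive_zero: "h 0 = 0"
  using h_add[of 0 0] by simp

lemma additive_uminus: "h (- \<alpha>) = - h \<alpha>"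
  using h_add[of \<alpha> "- \<alpha>"] by (simp add: additive_zero)

lemma additive_diff: "h (\<alpha> - \<beta>) = h \<alpha> - h \<beta>"
  using h_add[of \<alpha> "- \<beta>"] by (simp add: additive_uminus)

lemma halfspace_levi_roots:
  "halfspace_roots h \<inter> uminus ` halfspace_roots h = {\<alpha> \<in> roots. h \<alpha> = 0}"
proof (rule set_eqI)
  fix \<alpha>
  show "\<alpha> \<in> halfspace_roots h \<inter> uminus ` halfspace_roots h \<longleftrightarrow> \<alpha> \<in> {\<alpha> \<in> roots. h \<alpha> = 0}"
    unfolding Int_iff mem_uminus_image by (auto simp: halfspace_roots_def additive_uminus)
qed

lemma halfspace_nilradical_roots:
  "halfspace_roots h - uminus ` halfspace_roots h = {\<alpha> \<in> roots. h \<alpha> > 0}"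
proof (rule set_eqI)
  fix \<alpha>
  show "\<alpha> \<in> halfspace_roots h - uminus ` halfspace_roots h \<longleftrightarrow> \<alpha> \<in> {\<alpha> \<in> roots. h \<alpha> > 0}"
    unfolding Diff_iff mem_uminus_image by (auto simp: halfspace_roots_def additive_uminus)
qed

lemma levi_carrier_halfspace:
  "levi_carrier (halfspace_roots h) = osp_on (\<lambda>i j. h (wt i) = h (wt j))"
  unfolding levi_carrier_eq[OF finite_halfspace] halfspace_levi_roots
  using osp_entry_root by (auto simp: osp_on_def additive_diff)

lemma nilradical_halfspace:
  "nilradical (halfspace_roots h) = osp_on (\<lambda>i j. h (wt j) < h (wt i))"
  unfolding nilradical_def halfspace_nilradical_roots
  using root_space_sum_eq[of "{\<alpha> \<in> roots. h \<alpha> > 0}"] finite_roots osp_entry_root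
  by (fastforce simp: osp_on_def additive_diff)

lemma parabolic_halfspace:
  assumes "\<alpha> \<in> roots" "h \<alpha> \<noteq> 0"
  shows "parabolic (halfspace_roots h)"
proof -
  have "halfspace_roots h \<noteq> roots"
    using assms uminus_mem_roots[OF assms(1)] additive_uminus[of \<alpha>] unfolding halfspace_roots_def
    by (smt (verit) mem_Collect_eq)
  moreover have "roots = halfspace_roots h \<union> uminus ` halfspace_roots h"
  proof (rule set_eqI)
    fix \<alpha>
    show "\<alpha> \<in> roots \<longleftrightarrow> \<alpha> \<in> halfspace_roots h \<union> uminus ` halfspace_roots h"
      unfolding Un_iff mem_uminus_image by (auto simp: halfspace_roots_def additive_uminus)
  qed
  ultimately show ?thesis
    unfolding parabolic_def by (auto simp: halfspace_roots_def h_add)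
qed

end

definition choice_sign :: "bool \<Rightarrow> int" where
  "choice_sign b = (if b then 1 else -1)"

text \<open>A sign for \<open>\<epsilon>\<^sub>1\<close> and for each \<open>\<delta>\<^sub>k\<close> chooses one index out of each dual pair. This functional
  is \<open>1\<close> on the weights of the chosen indices and \<open>-1\<close> on the others.\<close>

definition half_height :: "(unit + 'n \<Rightarrow> bool) \<Rightarrow> 'n::finite weight \<Rightarrow> int" where
  "half_height s \<alpha> = choice_sign (s (Inl ())) * fst \<alpha> + (\<Sum>k\<in>UNIV. choice_sign (s (Inr k)) * snd \<alpha> $ k)"

definition pole_height :: "bool \<Rightarrow> 'n::finite weight \<Rightarrow> int" where
  "pole_height b \<alpha> = choice_sign b * fst \<alpha>"

abbreviation P_half :: "(unit + 'n \<Rightarrow> bool) \<Rightarrow> 'n::finite weight set" where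
  "P_half s \<equiv> halfspace_roots (half_height s)"

abbreviation P_pole :: "bool \<Rightarrow> 'n::finite weight set" where
  "P_pole b \<equiv> halfspace_roots (pole_height b)"

lemma half_height_add: "half_height s (\<alpha> + \<beta>) = half_height s \<alpha> + half_height s \<beta>"
  by (simp add: half_height_def algebra_simps sum.distrib)

lemma pole_height_add: "pole_height b (\<alpha> + \<beta>) = pole_height b \<alpha> + pole_height b \<beta>"
  by (simp add: pole_height_def algebra_simps)

lemma half_height_simps [simp]:
  "half_height s (\<alpha> + \<beta>) = half_height s \<alpha> + half_height s \<beta>"
  "half_height s (- \<alpha>) = - half_height s \<alpha>"
  "half_height s (\<alpha> - \<beta>) = half_height s \<alpha> - half_height s \<beta>"
  "half_height s eps = choice_sign (s (Inl ()))"
  "half_height s (delta k) = choice_sign (s (Inr k))"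
proof -
  show "half_height s (delta k) = choice_sign (s (Inr k))"
    by (simp add: half_height_def delta_def axis_def if_distrib[of "\<lambda>x. _ * x"] sum.delta cong: if_cong)
  show "half_height s eps = choice_sign (s (Inl ()))"
    by (simp add: half_height_def eps_def)
qed (rule additive_diff[OF half_height_add] additive_uminus[OF half_height_add] half_height_add)+

lemma pole_height_simps [simp]:
  "pole_height s (\<alpha> + \<beta>) = pole_height s \<alpha> + pole_height s \<beta>"
  "pole_height s (- \<alpha>) = - pole_height s \<alpha>"
  "pole_height s (\<alpha> - \<beta>) = pole_height s \<alpha> - pole_height s \<beta>"
  "pole_height s eps = choice_sign s"
  "pole_height s (delta k) = 0"
  by (simp_all add: pole_height_def eps_def delta_def algebra_simps)

text \<open>The \<open>n + 1\<close> dual pairs of indices are labelled by \<open>unit + 'n\<close>, the index type of \<open>gl(1|n)\<close>.\<close>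

fun slot :: "'n osp_index \<Rightarrow> unit + 'n" where
  "slot (Inl _) = Inl ()"
| "slot (Inr (k, _)) = Inr k"

fun half_index :: "(unit + 'n \<Rightarrow> bool) \<Rightarrow> unit + 'n \<Rightarrow> 'n osp_index" where
  "half_index s (Inl x) = Inl (s (Inl x))"
| "half_index s (Inr k) = Inr (k, s (Inr k))"

definition in_half :: "(unit + 'n \<Rightarrow> bool) \<Rightarrow> 'n osp_index \<Rightarrow> bool" where
  "in_half s i \<longleftrightarrow> half_index s (slot i) = i"

lemma half_height_wt: "half_height s (wt i) = choice_sign (in_half s i)"
  by (cases i rule: dual.cases) (auto simp: in_half_def choice_sign_def)

lemma pole_height_wt:
  "pole_height b (wt i) = (if par i then 0 else choice_sign (i = Inl b))"
  by (cases i rule: dual.cases) (auto simp: choice_sign_def)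

lemma super_bracket_nth_eq_0:
  assumes "\<And>k. X $ i $ k * Y $ k $ j = 0" "\<And>k. Y $ i $ k * X $ k $ j = 0"
  shows "super_bracket p X Y $ i $ j = 0"
  unfolding super_bracket_nth assms by simp

text \<open>Entries of elements of the nilradical lower the height strictly from row to column. The height
  of an index takes two values only, so two such entries never compose.\<close>

lemma cominuscule_P_half: "cominuscule (P_half s)"
proof -
  have "parabolic (P_half s)"
    by (rule parabolic_halfspace[of _ "wt (Inr p) + wt (Inr p)" for p, OF half_height_add])
       (auto simp: wt_add_mem_roots half_height_wt choice_sign_def)
  moreover have "super_bracket par X Y = 0"
    if "X \<in> nilradical (P_half s)" "Y \<in> nilradical (P_half s)" for X Y
  proof -
    have "A $ i $ k * B $ k $ j = 0" if "A \<in> nilradical (P_half s)" "B \<in> nilradical (P_half s)" for A B i j k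
      using that unfolding nilradical_halfspace[OF half_height_add]
      by (auto simp: osp_on_def half_height_wt choice_sign_def split: if_splits)
    from this[OF that] this[OF that(2,1)] show ?thesis
      by (simp add: vec_eq_iff super_bracket_nth_eq_0 del: mult_eq_0_iff)
  qed
  ultimately show ?thesis by (simp add: cominuscule_def)
qed

text \<open>Here two entries can compose, but only to an entry of weight \<open>\<plusminus>2\<epsilon>\<^sub>1\<close>, and these vanish
  on \<open>osp(2|2n)\<close>.\<close>

lemma cominuscule_P_pole: "cominuscule (P_pole b :: 'n::finite weight set)"
proof -
  have "parabolic (P_pole b :: 'n weight set)"
    by (rule parabolic_halfspace[of _ "wt (Inl True) + wt (Inr p)" for p, OF pole_height_add])
       (auto simp: wt_add_mem_roots pole_height_wt choice_sign_def simp del: wt.simps)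
  moreover have "super_bracket par X Y $ i $ j = 0"
    if X: "X \<in> nilradical (P_pole b)" and Y: "Y \<in> nilradical (P_pole b)" for X Y :: "'n osp_matrix" and i j
  proof (cases "i = Inl b \<and> j = Inl (\<not> b)")
    case True
    have "X \<in> osp" "Y \<in> osp"
      using X Y unfolding nilradical_halfspace[OF pole_height_add] by (auto dest: osp_onD)
    from osp_isotropic_entry[OF osp_bracket[OF this], of i] True show ?thesis by simp
  next
    case False
    have "A $ i $ k * B $ k $ j = 0" if "A \<in> nilradical (P_pole b)" "B \<in> nilradical (P_pole b)" for A B :: "'n osp_matrix" and k
    proof (rule ccontr)
      assume "A $ i $ k * B $ k $ j \<noteq> 0"
      then have "pole_height b (wt k) < pole_height b (wt i)" "pole_height b (wt j) < pole_height b (wt k)"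
        using that unfolding nilradical_halfspace[OF pole_height_add] by (auto simp: osp_on_def)
      then show False
        using False by (cases i; cases j) (auto simp: pole_height_wt choice_sign_def split: if_splits)
    qed
    from this[OF X Y] this[OF Y X] show ?thesis
      by (simp add: super_bracket_nth_eq_0 del: mult_eq_0_iff)
  qed
  ultimately show ?thesis by (simp add: cominuscule_def vec_eq_iff)
qed

lemma P_zero_eq: "P_zero = P_pole True"
proof -
  have "P_zero \<subseteq> roots"
    by (auto simp: P_zero_def roots_def odd_roots_def)
  then show ?thesis
    unfolding halfspace_roots_def
    by (auto simp: P_zero_def roots_def odd_roots_def even_roots_def choice_sign_def)
qed

lemma minus_P_zero_eq: "uminus ` P_zero = P_pole False"
proof (rule set_eqI)
  fix \<alpha> :: "'a weight"
  show "\<alpha> \<in> uminus ` P_zero \<longleftrightarrow> \<alpha> \<in> P_pole False"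
    unfolding mem_uminus_image P_zero_eq by (auto simp: halfspace_roots_def pole_height_def choice_sign_def)
qed

lemma P_n_eq: "P_n = P_half (\<lambda>_. True)"
proof -
  have "P_n \<subseteq> roots"
    by (auto simp: P_n_def roots_def odd_roots_def even_roots_def)
  then show ?thesis
    unfolding halfspace_roots_def
    by (auto simp: P_n_def roots_def odd_roots_def even_roots_def choice_sign_def)
qed

lemma Pbar_n_eq: "Pbar_n = P_half (\<lambda>a. a \<noteq> Inl ())"
proof -
  have "Pbar_n \<subseteq> roots"
    by (auto simp: Pbar_n_def roots_def odd_roots_def even_roots_def)
  then show ?thesis
    unfolding halfspace_roots_def
    by (auto simp: Pbar_n_def roots_def odd_roots_def even_roots_def choice_sign_def)
qed

section \<open>Orbits of the Weyl group\<close>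

text \<open>A signed permutation permutes the weights \<open>\<plusminus>\<epsilon>\<^sub>1\<close>, \<open>\<plusminus>\<delta>\<^sub>k\<close> and preserves parities, hence
  permutes the roots. It then suffices to transport the functional that defines the half-space.\<close>

lemma weyl_image:
  assumes "w = (\<lambda>(a, v). (a, \<chi> k. (r k :: int) * v $ (\<sigma> k :: 'n)))"
    and r: "\<And>k. r k = 1 \<or> r k = -1" and \<sigma>: "bij \<sigma>"
    and h: "\<And>\<alpha>. h' (w \<alpha>) = h \<alpha>"
  shows "w ` halfspace_roots h = (halfspace_roots h' :: 'n::finite weight set)"
proof -
  have add: "w (\<alpha> + \<beta>) = w \<alpha> + w \<beta>" for \<alpha> \<beta>
    by (cases \<alpha>; cases \<beta>) (simp add: assms(1) vec_eq_iff distrib_left)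
  have "inj w"
  proof (rule injI)
    fix \<alpha> \<beta> assume eq: "w \<alpha> = w \<beta>"
    have "snd \<alpha> $ \<sigma> k = snd \<beta> $ \<sigma> k" for k
    proof -
      have "r k * snd \<alpha> $ \<sigma> k = r k * snd \<beta> $ \<sigma> k"
        using eq by (cases \<alpha>; cases \<beta>) (simp add: assms(1) vec_eq_iff)
      then show ?thesis using r[of k] by auto
    qed
    then have "snd \<alpha> $ l = snd \<beta> $ l" for l
      using \<sigma> by (metis bij_pointE)
    moreover have "fst \<alpha> = fst \<beta>" using eq by (auto simp: assms(1) split: prod.splits)
    ultimately show "\<alpha> = \<beta>" by (simp add: prod_eq_iff vec_eq_iff)
  qed
  have zero: "w 0 = 0" using add[of 0 0] by simp
  have uminus: "w (- \<alpha>) = - w \<alpha>" for \<alpha> using add[of \<alpha> "- \<alpha>"] zero by (simp add: eq_neg_iff_add_eq_0 add.commute)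
  have wt: "\<exists>j. w (wt i) = wt j \<and> par j = par i" for i
  proof (cases i rule: dual.cases)
    case (1 s)
    then show ?thesis using uminus
      by (intro exI[of _ i]) (auto simp: assms(1) eps_def vec_eq_iff)
  next
    case (2 l s)
    define k where "k = inv \<sigma> l"
    have "\<sigma> m = l \<longleftrightarrow> m = k" for m
      using \<sigma> by (metis bij_inv_eq_iff k_def)
    then have "w (delta l) = (if r k = 1 then delta k else - delta k)"
      using r[of k] by (auto simp: assms(1) delta_def vec_eq_iff axis_def)
    then show ?thesis using uminus 2
      by (intro exI[of _ "Inr (k, s = (r k = 1))"]) auto
  qed
  have "w ` roots \<subseteq> roots"
  proof
    fix \<beta> assume "\<beta> \<in> w ` roots"
    then obtain i j where ij: "\<beta> = w (wt i - wt j)" "i \<noteq> j" "par i \<or> par j"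
      by (auto elim: rootsE)
    obtain i' j' where *: "w (wt i) = wt i'" "par i' = par i" "w (wt j) = wt j'" "par j' = par j"
      using wt by metis
    have "i' \<noteq> j'" using ij(2) * \<open>inj w\<close> by (metis injD wt_inj)
    moreover have "\<beta> = wt i' - wt j'" using ij(1) * add[of "wt i" "- wt j"] by (simp add: uminus)
    ultimately show "\<beta> \<in> roots" using ij(3) * by (simp add: wt_diff_mem_roots)
  qed
  then have "w ` roots = roots"
    using endo_inj_surj[OF finite_roots _ inj_on_subset[OF \<open>inj w\<close> subset_UNIV]] by blast
  moreover have "w ` {\<alpha> \<in> roots. 0 \<le> h' (w \<alpha>)} = {\<beta> \<in> w ` roots. 0 \<le> h' \<beta>}"
    by auto
  ultimately show ?thesis
    by (simp only: halfspace_roots_def h)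
qed

lemma weyl_orbit_P_pole: "weyl_orbit (P_pole b) = {P_pole b}"
proof -
  have "w ` P_pole b = P_pole b" if "w \<in> weyl_group" for w
  proof -
    from that obtain r \<sigma> where "w = (\<lambda>(a, v). (a, \<chi> k. r k * v $ \<sigma> k))"
      "\<forall>k. r k = 1 \<or> r k = -1" "bij \<sigma>" unfolding weyl_group_def by blast
    then show ?thesis
      by (intro weyl_image[of w r \<sigma>]) (auto simp: pole_height_def split: prod.split)
  qed
  moreover have "id \<in> weyl_group"
    unfolding weyl_group_def by (intro CollectI exI[of _ "\<lambda>_. 1"] exI[of _ id]) auto
  ultimately show ?thesis unfolding weyl_orbit_def by (auto simp: image_iff)
qed

text \<open>The transported functional is again a half height: permutations move the signs of the \<open>\<delta>\<^sub>k\<close> around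
  and sign changes alter them, while the sign of \<open>\<epsilon>\<^sub>1\<close> stays. Sign changes alone already reach every
  choice of signs.\<close>

lemma weyl_orbit_P_half:
  fixes s :: "unit + 'n::finite \<Rightarrow> bool"
  shows "weyl_orbit (P_half s) = P_half ` {t. t (Inl ()) = s (Inl ())}"
proof (intro equalityI subsetI)
  fix Q :: "'n weight set" assume "Q \<in> weyl_orbit (P_half s)"
  then obtain w r \<sigma> where w: "w = (\<lambda>(a, v). (a, \<chi> k. r k * v $ \<sigma> k))"
    "\<forall>k. r k = 1 \<or> r k = -1" "bij \<sigma>" "Q = w ` P_half s"
    unfolding weyl_orbit_def weyl_group_def by blast
  define t :: "unit + 'n \<Rightarrow> bool" where "t = case_sum (\<lambda>x. s (Inl ())) (\<lambda>k. s (Inr (\<sigma> k)) = (r k = 1))"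
  have "half_height t (w \<alpha>) = half_height s \<alpha>" for \<alpha>
  proof -
    have "choice_sign (t (Inr k)) * r k = choice_sign (s (Inr (\<sigma> k)))" for k
      using w(2)[rule_format, of k] by (auto simp: t_def choice_sign_def)
    then show ?thesis
      using sum.reindex_bij_betw[OF w(3), of "\<lambda>k. choice_sign (s (Inr k)) * snd \<alpha> $ k"]
      by (cases \<alpha>) (simp add: half_height_def w(1) mult.assoc[symmetric], simp add: t_def)
  qed
  then have "Q = P_half t"
    unfolding w(4) using w(2,3) by (intro weyl_image[OF w(1)]) auto
  then show "Q \<in> P_half ` {t. t (Inl ()) = s (Inl ())}" by (auto simp: t_def)
next
  fix Q :: "'n weight set" assume "Q \<in> P_half ` {t. t (Inl ()) = s (Inl ())}"
  then obtain t where t: "t (Inl ()) = s (Inl ())" "Q = P_half t" by auto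
  define r where "r k = choice_sign (t (Inr k)) * choice_sign (s (Inr k))" for k
  define w :: "'n weight \<Rightarrow> 'n weight" where "w = (\<lambda>(a, v). (a, \<chi> k. r k * v $ id k))"
  have r: "r k = 1 \<or> r k = -1" for k by (auto simp: r_def choice_sign_def)
  have "half_height t (w \<alpha>) = half_height s \<alpha>" for \<alpha>
  proof -
    have "choice_sign (t (Inr k)) * r k = choice_sign (s (Inr k))" for k
      by (auto simp: r_def choice_sign_def)
    then show ?thesis
      by (cases \<alpha>) (simp add: half_height_def w_def t(1) mult.assoc[symmetric])
  qed
  then have "w ` P_half s = Q"
    using weyl_image[OF w_def r bij_id] by (simp add: t)
  moreover have "w \<in> weyl_group"
    unfolding weyl_group_def w_def using r by blast
  ultimately show "Q \<in> weyl_orbit (P_half s)"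
    unfolding weyl_orbit_def by blast
qed

section \<open>Classification of the cominuscule parabolic sets\<close>

lemma in_half_Inl [simp]: "in_half s (Inl c) \<longleftrightarrow> s (Inl ()) = c"
  by (simp add: in_half_def)

lemma in_half_Inr [simp]: "in_half s (Inr (k, c)) \<longleftrightarrow> s (Inr k) = c"
  by (simp add: in_half_def)

lemma in_half_dual [simp]: "in_half s (dual i) \<longleftrightarrow> \<not> in_half s i"
  by (cases i rule: dual.cases) auto

text \<open>Half heights serve as test functionals: any set without dual pairs of indices is contained in the
  chosen half for suitable signs.\<close>

lemma ex_half:
  assumes "\<And>i. i \<in> A \<Longrightarrow> dual i \<notin> A"
  shows "\<exists>s. \<forall>i\<in>A. in_half s i"
proof (intro exI ballI)
  fix i assume "i \<in> A"
  show "in_half (case_sum (\<lambda>_. Inl True \<in> A) (\<lambda>k. Inr (k, True) \<in> A)) i"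
  proof (cases i rule: dual.cases)
    case (1 t)
    with \<open>i \<in> A\<close> assms[of i] show ?thesis by (cases t) auto
  next
    case (2 k t)
    with \<open>i \<in> A\<close> assms[of i] show ?thesis by (cases t) auto
  qed
qed

text \<open>For a half that contains \<open>i\<close> and \<open>j\<close>, both sides have height 2, so \<open>k\<close> lies in that half. Unless \<open>k\<close>
  is \<open>i\<close> or \<open>j\<close>, the half can be chosen to contain \<open>k\<^sup>*\<close> instead.\<close>

lemma wt_sum_eq:
  assumes "wt i + wt j = wt k + wt m" "j \<noteq> dual i"
  shows "k = i \<or> k = j"
proof (rule ccontr)
  assume k: "\<not> (k = i \<or> k = j)"
  have "\<exists>s. \<forall>l\<in>{i, j, dual k}. in_half s l"
    using assms(2) k by (intro ex_half) auto
  then obtain s where s: "in_half s i" "in_half s j" "\<not> in_half s k" by auto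
  have "half_height s (wt i + wt j) = half_height s (wt k + wt m)"
    by (simp only: assms(1))
  then show False
    using s by (simp add: half_height_wt choice_sign_def split: if_splits)
qed

text \<open>The matrix unit at \<open>(i, k)\<close> together with the entry at \<open>(k\<^sup>*, i\<^sup>*)\<close> that membership in \<open>osp(2|2n)\<close>
  forces. For \<open>i = k\<^sup>*\<close> the two positions coincide and the terms add up, to \<open>2\<close> in the case of a long
  root and to \<open>0\<close> for \<open>\<plusminus>2\<epsilon>\<^sub>1\<close>.\<close>

definition root_vector :: "'n::finite osp_index \<Rightarrow> 'n osp_index \<Rightarrow> 'n osp_matrix" where
  "root_vector i k = (\<chi> a b. (if a = i \<and> b = k then 1 else 0) +
     (if a = dual k \<and> b = dual i then swap_sign b a else 0))"

lemma root_vector_in_root_space: "root_vector i k \<in> root_space (wt i - wt k)"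
  unfolding root_space_eq
proof (rule osp_onI)
  show "root_vector i k \<in> osp"
    unfolding osp_iff
  proof (intro allI)
    fix b a :: "'a osp_index"
    show "root_vector i k $ a $ b = swap_sign b a * root_vector i k $ dual b $ dual a"
    proof -
      define A B where "A \<longleftrightarrow> a = i \<and> b = k" and "B \<longleftrightarrow> a = dual k \<and> b = dual i"
      have "(dual b = i \<and> dual a = k) = B" "(dual b = dual k \<and> dual a = dual i) = A"
        by (simp_all only: A_def B_def dual_eq_iff dual_eq_flip[of b i] dual_eq_flip[of a k] conj_commute)
      then have "root_vector i k $ dual b $ dual a =
          (if B then 1 else 0) + (if A then swap_sign (dual a) (dual b) else 0)"
        by (simp only: root_vector_def vec_lambda_beta)
      moreover have "root_vector i k $ a $ b = (if A then 1 else 0) + (if B then swap_sign b a else 0)"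
        by (simp only: root_vector_def vec_lambda_beta A_def B_def)
      ultimately show ?thesis
        by (cases A; cases B) (simp_all add: distrib_left)
    qed
  qed
  show "wt a - wt b = wt i - wt k" if "root_vector i k $ a $ b \<noteq> 0" for a b
    using that by (auto simp: root_vector_def split: if_splits)
qed

lemma root_vector_entry:
  assumes "par i \<or> par k"
  shows "root_vector i k $ i $ k \<noteq> 0"
proof (cases "i = dual k")
  case True
  then show ?thesis
    using assms swap_sign_simps(2)[of k] by (simp add: root_vector_def)
next
  case False
  then show ?thesis by (simp add: root_vector_def)
qed

text \<open>In the entry at \<open>(i, j)\<close> of the bracket, the first product contributes only through \<open>k\<close>. The second
  one contributes only if \<open>wt i + wt j\<close> can be written as a sum with \<open>wt k\<close> in another way, that is,
  if \<open>j = i\<^sup>*\<close>; it then contributes through \<open>k\<^sup>*\<close>, and both contributions agree.\<close>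

lemma root_vectors_bracket:
  fixes i j k :: "'a::finite osp_index"
  assumes "i \<noteq> k" "k \<noteq> j" "par i \<or> par k" "par k \<or> par j" "par i \<or> par j"
  shows "super_bracket par (root_vector i k) (root_vector k j) $ i $ j \<noteq> 0"
proof -
  define X Y where "X = root_vector i k" and "Y = root_vector k j"
  have nz: "X $ i $ k \<noteq> 0" "Y $ k $ j \<noteq> 0"
    using assms by (simp_all add: X_def Y_def root_vector_entry)
  have X: "X \<in> osp_on (\<lambda>a b. wt a - wt b = wt i - wt k)"
    and Y: "Y \<in> osp_on (\<lambda>a b. wt a - wt b = wt k - wt j)"
    unfolding X_def Y_def using root_vector_in_root_space by (simp_all add: root_space_eq)
  have X0: "X $ i $ m = 0" if "m \<noteq> k" for m :: "'a osp_index"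
    using osp_onD(2)[OF X, of i m] that by simp
  have Ym: "m = dual k \<and> j = dual i" if "Y $ i $ m \<noteq> 0" for m :: "'a osp_index"
  proof -
    have eq: "wt i + wt j = wt k + wt m"
      using osp_onD(2)[OF Y, of i m] that by (auto simp: algebra_simps)
    then have "j = dual i" using wt_sum_eq assms(1,2) by blast
    moreover from this eq have "wt m = wt (dual k)" by (simp add: eq_neg_iff_add_eq_0 add.commute)
    ultimately show ?thesis by (simp only: wt_inj)
  qed
  have sum1: "(\<Sum>m\<in>UNIV. X $ i $ m * Y $ m $ j) = X $ i $ k * Y $ k $ j"
    using X0 by (subst sum.remove[of _ k]) (auto intro!: sum.neutral)
  define z :: "'a osp_index \<Rightarrow> complex" where "z m = koszul (par i \<noteq> par m) (par m \<noteq> par j)" for m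
  have split: "super_bracket par X Y $ i $ j =
      X $ i $ k * Y $ k $ j - (\<Sum>m\<in>UNIV. z m * (Y $ i $ m * X $ m $ j))"
    unfolding super_bracket_nth z_def[symmetric] sum_subtractf sum1 ..
  show ?thesis
  proof (cases "j = dual i")
    case False
    then have "Y $ i $ m = 0" for m using Ym by blast
    then show ?thesis
      using split nz by (simp add: X_def Y_def)
  next
    case True
    then have "par i" using assms(5) by simp
    have "(\<Sum>m\<in>UNIV. z m * (Y $ i $ m * X $ m $ j)) = z (dual k) * (Y $ i $ dual k * X $ dual k $ j)"
      using Ym by (subst sum.remove[of _ "dual k"]) (auto intro!: sum.neutral)
    moreover have "X $ i $ k * Y $ k $ j = (swap_sign k i * swap_sign j k) * (Y $ i $ dual k * X $ dual k $ j)"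
      using ospD[OF osp_onD(1)[OF X], of i k] ospD[OF osp_onD(1)[OF Y], of k j] True by simp
    moreover have "swap_sign k i * swap_sign j k = - z (dual k)"
    proof -
      have "swap_sign k i * swap_sign j k =
         koszul (par k \<noteq> par i) (par k) * koszul (par i \<noteq> par k) (par i) *
         (form_sign i * form_sign (dual i)) * (form_sign (dual k) * form_sign (dual k))"
        using True by (simp add: swap_sign_def mult_ac)
      then show ?thesis
        using \<open>par i\<close> True by (cases "par k") (simp_all add: form_sign_dual koszul_def z_def)
    qed
    ultimately have "super_bracket par X Y $ i $ j = 2 * (X $ i $ k * Y $ k $ j)"
      using split by simp
    then show ?thesis
      using nz by (simp add: X_def Y_def)
  qed
qed

context
  fixes P :: "'n::finite weight set"
  assumes com: "cominuscule P"
begin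

definition nil_roots :: "'n weight set" where
  "nil_roots = P - uminus ` P"

lemma P_roots: "P \<subseteq> roots" "P \<noteq> roots"
  and P_closed: "\<alpha> \<in> P \<Longrightarrow> \<beta> \<in> P \<Longrightarrow> \<alpha> + \<beta> \<in> roots \<Longrightarrow> \<alpha> + \<beta> \<in> P"
  using com unfolding cominuscule_def parabolic_def by blast+

lemma P_total:
  assumes "\<alpha> \<in> roots"
  shows "\<alpha> \<in> P \<or> - \<alpha> \<in> P"
proof -
  have "\<alpha> \<in> P \<union> uminus ` P"
    using assms com unfolding cominuscule_def parabolic_def by blast
  then show ?thesis by (simp add: mem_uminus_image)
qed

lemma nil_roots_iff: "\<alpha> \<in> nil_roots \<longleftrightarrow> \<alpha> \<in> P \<and> - \<alpha> \<notin> P"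
  by (simp add: nil_roots_def mem_uminus_image)

lemma nil_or_minus: "\<alpha> \<in> roots \<Longrightarrow> \<alpha> \<notin> P \<Longrightarrow> - \<alpha> \<in> nil_roots"
  using P_total[of \<alpha>] by (auto simp: nil_roots_iff)

text \<open>Otherwise \<open>-\<alpha> = -(\<alpha> + \<beta>) + \<beta>\<close> would lie in \<open>P\<close>.\<close>

lemma nil_roots_add:
  assumes "\<alpha> \<in> nil_roots" "\<beta> \<in> P" "\<alpha> + \<beta> \<in> roots"
  shows "\<alpha> + \<beta> \<in> nil_roots"
proof -
  have "- (\<alpha> + \<beta>) \<notin> P"
  proof
    assume "- (\<alpha> + \<beta>) \<in> P"
    moreover have "- (\<alpha> + \<beta>) + \<beta> \<in> roots"
      using assms(1) P_roots by (auto simp: nil_roots_iff)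
    ultimately have "- (\<alpha> + \<beta>) + \<beta> \<in> P" using assms(2) by (blast intro: P_closed)
    then show False using assms(1) by (simp add: nil_roots_iff)
  qed
  then show ?thesis using assms P_closed by (auto simp: nil_roots_iff)
qed

text \<open>The only place where commutativity of the nilradical enters: root vectors for the two summands would
  have a nonzero bracket.\<close>

lemma no_nil_sum:
  assumes "wt i - wt k \<in> nil_roots" "wt k - wt j \<in> nil_roots" "par i \<or> par j"
  shows False
proof -
  have fin: "finite nil_roots"
    unfolding nil_roots_def using finite_roots P_roots(1) by (blast intro: finite_subset)
  have sub: "root_space \<alpha> \<subseteq> nilradical P" if "\<alpha> \<in> nil_roots" for \<alpha>
    unfolding nilradical_def nil_roots_def[symmetric] root_space_sum_eq[OF fin] root_space_eq
    using that by (auto intro!: osp_on_mono)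
  have "super_bracket par (root_vector i k) (root_vector k j) = 0"
    using com sub[OF assms(1)] sub[OF assms(2)] root_vector_in_root_space
    unfolding cominuscule_def by blast
  moreover have "wt i - wt k \<in> roots" "wt k - wt j \<in> roots"
    using assms P_roots(1) unfolding nil_roots_iff by blast+
  ultimately show False
    using root_vectors_bracket[of i k j] assms(3) by (simp add: wt_diff_mem_roots)
qed

text \<open>The conditions determine on which side of \<open>P\<close> each root lies, because roots of negative height are the
  negatives of roots of positive height.\<close>

lemma eq_halfspace:
  assumes "\<And>i j. i \<noteq> j \<Longrightarrow> par i \<or> par j \<Longrightarrow> h (wt j) < h (wt i) \<Longrightarrow> wt i - wt j \<in> nil_roots"
    and "\<And>i j. i \<noteq> j \<Longrightarrow> par i \<or> par j \<Longrightarrow> h (wt i) = h (wt j) \<Longrightarrow> wt i - wt j \<in> P"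
    and h: "\<And>\<alpha> \<beta>. h (\<alpha> + \<beta>) = (h \<alpha> + h \<beta> :: int)"
  shows "P = halfspace_roots h"
proof -
  have "\<alpha> \<in> P \<longleftrightarrow> 0 \<le> h \<alpha>" if \<alpha>: "\<alpha> \<in> roots" for \<alpha>
  proof -
    obtain i j where ij: "\<alpha> = wt i - wt j" "i \<noteq> j" "par i \<or> par j"
      by (rule rootsE[OF \<alpha>])
    have "- \<alpha> = wt j - wt i" using ij by simp
    then show ?thesis
      using assms(1)[of i j] assms(1)[of j i] assms(2)[of i j] ij
      by (cases "h (wt i)" "h (wt j)" rule: linorder_cases)
         (auto simp: nil_roots_iff additive_diff[OF h])
  qed
  then show ?thesis using P_roots(1) by (auto simp: halfspace_roots_def)
qed

text \<open>If this fails for both signs, then \<open>N\<close> contains \<open>-\<epsilon>\<^sub>1 - \<alpha>\<close> and \<open>\<epsilon>\<^sub>1 - \<beta>\<close> for some weights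
  \<open>\<alpha>\<close>, \<open>\<beta>\<close> among the \<open>\<plusminus>\<delta>\<^sub>k\<close>. Their sum is a root or zero, and both are excluded.\<close>

lemma odd_roots_one_sided: "\<exists>b. \<forall>i. par i \<longrightarrow> wt (Inl b) + wt i \<in> P"
proof (rule ccontr)
  assume no: "\<not> ?thesis"
  then obtain i where i: "par i" "wt (Inl True) + wt i \<notin> P" by blast
  from no obtain j where j: "par j" "wt (Inl False) + wt j \<notin> P" by blast
  have "wt (dual i) - wt (Inl True) \<in> nil_roots"
  proof -
    have "wt (dual i) - wt (Inl True) = - (wt (Inl True) + wt i)" by simp
    moreover have "wt (Inl True) + wt i \<in> roots"
      using i(1) by (subst wt_add_mem_roots) auto
    ultimately show ?thesis
      using nil_or_minus i(2) by metis
  qed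
  moreover have "wt (Inl True) - wt j \<in> nil_roots"
    using nil_or_minus[OF _ j(2)] j(1) wt_add_mem_roots[of "Inl False" j] by (cases j) auto
  ultimately show False using no_nil_sum j(1) by blast
qed

text \<open>With \<open>e = \<plusminus>\<epsilon>\<^sub>1\<close> such that all odd roots \<open>e + \<alpha>\<close> lie in \<open>P\<close>, every other root is a negative or a
  difference of these, so their position relative to \<open>N\<close> determines \<open>P\<close>.\<close>

lemma classification: "(\<exists>b. P = P_pole b) \<or> (\<exists>s. P = P_half s)"
proof -
  obtain b where b: "\<And>i. par i \<Longrightarrow> wt (Inl b) + wt i \<in> P"
    using odd_roots_one_sided by blast
  define e :: "'n weight" where "e = wt (Inl b)"
  have e_dual: "wt (Inl (\<not> b)) = - e"
    unfolding e_def by simp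
  have index_cases: "par i \<or> i = Inl b \<or> i = Inl (\<not> b)" for i :: "'n osp_index"
    by (cases i) auto
  have inP: "e + wt i \<in> P" "e - wt i \<in> P" if "par i" for i
    using b[OF that] b[of "dual i"] that by (simp_all add: e_def)
  have minusP: "- (e + wt i) \<in> P" if "par i" "e + wt i \<notin> nil_roots" for i
    using that inP nil_roots_iff by blast
  consider (all) "\<forall>i. par i \<longrightarrow> e + wt i \<in> nil_roots"
    | (none) "\<forall>i. par i \<longrightarrow> e + wt i \<notin> nil_roots"
    | (mixed) a c where "par a" "e + wt a \<notin> nil_roots" "par c" "e + wt c \<in> nil_roots"
    by blast
  then show ?thesis
  proof cases
    case all
    then have minus: "e - wt i \<in> nil_roots" if "par i" for i
      using that all[rule_format, of "dual i"] by simp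
    have "P = P_pole b"
    proof (rule eq_halfspace[OF _ _ pole_height_add])
      fix i j :: "'n osp_index" assume ij: "i \<noteq> j" "par i \<or> par j"
      {
        assume "pole_height b (wt j) < pole_height b (wt i)"
        then have "i = Inl b \<and> par j \<or> par i \<and> j = Inl (\<not> b)"
          using ij index_cases[of i] index_cases[of j] by (auto simp: pole_height_wt choice_sign_def split: if_splits)
        then show "wt i - wt j \<in> nil_roots"
          using all minus e_dual by (auto simp: e_def add.commute)
      }
      assume "pole_height b (wt i) = pole_height b (wt j)"
      then have "par i" "par j"
        using ij by (auto simp: pole_height_wt choice_sign_def split: if_splits)
      show "wt i - wt j \<in> P"
      proof (rule ccontr)
        \<comment> \<open>otherwise \<open>e - wt j\<close> and \<open>wt j - wt i\<close> would be elements of \<open>N\<close> with sum the root \<open>e - wt i\<close>\<close>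
        assume "wt i - wt j \<notin> P"
        then have "wt j - wt i \<in> nil_roots"
          using nil_or_minus[of "wt i - wt j"] ij by (simp add: wt_diff_mem_roots)
        then show False
          using no_nil_sum[of "Inl b" j i] minus[OF \<open>par j\<close>] \<open>par i\<close> by (simp add: e_def)
      qed
    qed
    then show ?thesis by blast
  next
    case none
    have "\<alpha> \<in> P" if \<alpha>: "\<alpha> \<in> roots" for \<alpha>
    proof -
      obtain i j where ij: "\<alpha> = wt i - wt j" "i \<noteq> j" "par i \<or> par j"
        by (rule rootsE[OF \<alpha>])
      have both: "wt k + e \<in> P" "- e - wt k \<in> P" "wt k - e \<in> P" "e - wt k \<in> P" if "par k" for k
        using that inP[of k] minusP[of k] minusP[of "dual k"] none none[rule_format, of "dual k"]
        by (auto simp: algebra_simps)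
      consider "par i" "par j" | "i = Inl b" "par j" | "i = Inl (\<not> b)" "par j"
        | "par i" "j = Inl b" | "par i" "j = Inl (\<not> b)"
        using ij index_cases by blast
      then show ?thesis
      proof cases
        case 1
        then show ?thesis
          using P_closed[of "wt i + e" "- e - wt j"] both \<alpha> ij by simp
      qed (use both ij e_dual in \<open>auto simp: e_def\<close>)
    qed
    then show ?thesis using P_roots by blast
  next
    case mixed
    \<comment> \<open>the sum of \<open>e + wt i\<close> in \<open>N\<close> and \<open>-(e + wt j)\<close> in \<open>P\<close>\<close>
    have nil_diff: "wt i - wt j \<in> nil_roots"
      if "par i" "par j" "e + wt i \<in> nil_roots" "e + wt j \<notin> nil_roots" for i j
    proof -
      have "i \<noteq> j" using that by auto
      then show ?thesis
        using nil_roots_add[OF that(3) minusP[OF that(2,4)]] that(1) by (simp add: wt_diff_mem_roots)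
    qed
    \<comment> \<open>two in \<open>N\<close>: \<open>e - wt i\<close> and \<open>wt i - wt a\<close> add up to \<open>e - wt a\<close>;
      none in \<open>N\<close>: \<open>wt c - wt i\<close> and \<open>wt c + wt i\<close> add up to \<open>2 wt c\<close>\<close>
    have exactly_one: "e + wt (dual i) \<in> nil_roots \<longleftrightarrow> e + wt i \<notin> nil_roots" if "par i" for i
    proof (rule ccontr)
      assume "\<not> ?thesis"
      then consider "e + wt i \<in> nil_roots" "wt (Inl b) - wt i \<in> nil_roots"
        | "e + wt i \<notin> nil_roots" "e + wt (dual i) \<notin> nil_roots"
        by (auto simp: e_def)
      then show False
      proof cases
        case 1
        then show False
          using nil_diff[OF that mixed(1) 1(1) mixed(2)] no_nil_sum mixed(1) by blast
      next
        case 2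
        have "wt c - wt i \<in> nil_roots" using nil_diff[OF mixed(3) that mixed(4) 2(1)] .
        moreover have "wt i - wt (dual c) \<in> nil_roots"
          using nil_diff[of c "dual i"] mixed that 2(2) by (simp add: add.commute)
        ultimately show False using no_nil_sum mixed(3) by blast
      qed
    qed
    define s where "s = case_sum (\<lambda>_::unit. b) (\<lambda>k. e + wt (Inr (k, True)) \<in> nil_roots)"
    have half_even: "in_half s i \<longleftrightarrow> i = Inl b" if "\<not> par i" for i
      using that by (cases i) (auto simp: s_def)
    have half_odd: "in_half s i \<longleftrightarrow> e + wt i \<in> nil_roots" if par: "par i" for i
    proof -
      obtain k t where i: "i = Inr (k, t)" using par by (cases i rule: dual.cases) auto
      show ?thesis
        using exactly_one[of "Inr (k, True)"] by (cases t) (simp_all add: s_def i)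
    qed
    \<comment> \<open>\<open>e - wt j\<close> and its negative lie in \<open>P\<close> for odd indices \<open>j\<close> in the half, so differences of these do\<close>
    have diff: "wt i - wt j \<in> P" if ij: "in_half s i" "in_half s j" "i \<noteq> j" for i j
    proof -
      have *: "e - wt k \<in> P" "- (e - wt k) \<in> P" if "par k" "in_half s k" for k
        using inP(2)[OF that(1)] minusP[of "dual k"] exactly_one[OF that(1)] half_odd[OF that(1)] that by simp_all
      consider "par i" "par j" | "i = Inl b" "par j" | "par i" "j = Inl b"
        using ij half_even by blast
      then show ?thesis
      proof cases
        case 1
        then show ?thesis
          using P_closed[OF *(2)[OF 1(1) ij(1)] *(1)[OF 1(2) ij(2)]] ij(3) by (simp add: wt_diff_mem_roots)
      qed (use * ij in \<open>auto simp: e_def\<close>)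
    qed
    have "P = P_half s"
    proof (rule eq_halfspace[OF _ _ half_height_add])
      fix i j :: "'n osp_index" assume ij: "i \<noteq> j" "par i \<or> par j"
      {
        assume "half_height s (wt j) < half_height s (wt i)"
        then have half: "in_half s i" "in_half s (dual j)"
          by (auto simp: half_height_wt choice_sign_def split: if_splits)
        consider "par i" "par j" | "i = Inl b" "par j" | "par i" "dual j = Inl b"
          using half half_even ij par_dual by metis
        then show "wt i - wt j \<in> nil_roots"
        proof cases
          case 1
          then have "e + wt j \<notin> nil_roots" using half half_odd by simp
          then show ?thesis using nil_diff half half_odd 1 by blast
        next
          case 2
          then show ?thesis using half half_odd[of "dual j"] by (simp add: e_def)
        next
          case 3
          have "- wt j = e" using wt_dual[of j] 3(2) by (simp only: e_def)
          then have "wt i - wt j = e + wt i" by (simp only: diff_conv_add_uminus add.commute)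
          then show ?thesis using half(1) half_odd[OF 3(1)] by (simp only:)
        qed
      }
      assume "half_height s (wt i) = half_height s (wt j)"
      then have "in_half s i = in_half s j"
        by (auto simp: half_height_wt choice_sign_def split: if_splits)
      then show "wt i - wt j \<in> P"
        using diff[of i j] diff[of "dual j" "dual i"] ij by auto
    qed
    then show ?thesis by blast
  qed
qed

end

lemma cominuscule_iff: "cominuscule P \<longleftrightarrow> (\<exists>b. P = P_pole b) \<or> (\<exists>s. P = P_half s)"
  using classification cominuscule_P_half cominuscule_P_pole by blast

section \<open>Isomorphisms from mutually inverse additive maps\<close>

lemma superspace_isoI:
  assumes f_add: "\<And>x y. f (x + y) = f x + f y" and g_add: "\<And>x y. g (x + y) = g x + g y"
    and scale: "\<And>c x. f (scl V c x) = scl W c (f x)"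
    and f: "\<And>d x. x \<in> homog V d \<Longrightarrow> f x \<in> homog W d" "\<And>d x. x \<in> homog V d \<Longrightarrow> g (f x) = x"
    and g: "\<And>d y. y \<in> homog W d \<Longrightarrow> g y \<in> homog V d" "\<And>d y. y \<in> homog W d \<Longrightarrow> f (g y) = y"
  shows "superspace_iso V W f"
  unfolding superspace_iso_def
proof (intro conjI ballI allI f_add scale)
  show "bij_betw f (whole_space V) (whole_space W)"
    by (rule bij_betw_byWitness[where f' = g])
       (force simp: whole_space_def f_add g_add f g)+
  show "f ` homog V d = homog W d" for d
    using f(1) g[of _ d] by (force simp: image_iff)
qed

lemma homog_matricesD: "X \<in> homog_matrices p d \<Longrightarrow> X $ i $ j \<noteq> 0 \<Longrightarrow> (p i \<noteq> p j) = d"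
  unfolding homog_matrices_def by blast

lemma whole_space_subset:
  assumes "\<And>d. homog V d \<subseteq> S" "\<And>x y. x \<in> S \<Longrightarrow> y \<in> S \<Longrightarrow> x + y \<in> S"
  shows "whole_space V \<subseteq> S"
  using assms unfolding whole_space_def by blast

lemma whole_space_levi: "whole_space (levi (halfspace_roots h)) \<subseteq> levi_carrier (halfspace_roots h)"
  by (rule whole_space_subset)
     (auto simp: levi_eq matrix_superalgebra_def levi_carrier_eq intro: osp_on_add)

lemma whole_space_nilradical:
  "whole_space (nilradical_module (halfspace_roots h)) \<subseteq> nilradical (halfspace_roots h)"
proof (rule whole_space_subset)
  show "x + y \<in> nilradical (halfspace_roots h)"
    if "x \<in> nilradical (halfspace_roots h)" "y \<in> nilradical (halfspace_roots h)" for x y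
    using that osp_on_add root_space_sum_eq[of "halfspace_roots h - uminus ` halfspace_roots h"]
    unfolding nilradical_def by simp
qed (simp add: nilradical_module_def)

section \<open>The Levi subalgebra and nilradical attached to a half of the weights\<close>

lemma slot_dual [simp]: "slot (dual i) = slot i"
  by (cases i rule: dual.cases) auto

lemma par_slot [simp]: "par (slot i) = par i"
  by (cases i rule: dual.cases) (auto simp: par_def)

lemma slot_half_index [simp]: "slot (half_index s a) = a"
  by (cases a) auto

lemma par_half_index [simp]: "par (half_index s a) = par a"
  by (cases a) (auto simp: par_def)

lemma in_half_half_index [simp]: "in_half s (half_index s a)"
  by (simp add: in_half_def)

lemma half_index_slot [simp]: "in_half s i \<Longrightarrow> half_index s (slot i) = i"
  by (simp add: in_half_def)

lemma half_index_slot_dual [simp]: "\<not> in_half s i \<Longrightarrow> half_index s (slot i) = dual i"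
  using half_index_slot[of s "dual i"] by simp

lemma sum_half:
  "(\<Sum>i\<in>UNIV. f i) = (\<Sum>a\<in>UNIV. f (half_index s a)) + (\<Sum>a\<in>UNIV. f (dual (half_index s a)))"
  for f :: "'n::finite osp_index \<Rightarrow> complex"
proof -
  have inj: "inj (half_index s)"
    by (rule inj_on_inverseI[of _ slot]) simp
  then have U: "inj (half_index s)" "inj (\<lambda>a. dual (half_index s a))"
    by (simp_all add: inj_on_def)
  have "i \<in> range (half_index s) \<union> range (\<lambda>a. dual (half_index s a))" for i
  proof (cases "in_half s i")
    case True
    then have "i = half_index s (slot i)" by simp
    then show ?thesis by blast
  next
    case False
    then have "i = dual (half_index s (slot i))" by simp
    then show ?thesis by blast
  qed
  then have "UNIV = range (half_index s) \<union> range (\<lambda>a. dual (half_index s a))"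
    by blast
  moreover have "range (half_index s) \<inter> range (\<lambda>a. dual (half_index s a)) = {}"
  proof -
    have "half_index s a \<noteq> dual (half_index s b)" for a b
      using in_half_half_index[of s a] in_half_dual[of s "half_index s b"] by fastforce
    then show ?thesis by blast
  qed
  ultimately have "sum f UNIV = sum f (range (half_index s)) + sum f (range (\<lambda>a. dual (half_index s a)))"
    by (metis finite sum.union_disjoint)
  then show ?thesis
    using U by (simp add: sum.reindex)
qed

lemma levi_carrier_half: "levi_carrier (P_half s) = osp_on (\<lambda>i j. in_half s i = in_half s j)"
proof -
  have "half_height s (wt i) = half_height s (wt j) \<longleftrightarrow> in_half s i = in_half s j" for i j
    by (auto simp: half_height_wt choice_sign_def)
  then show ?thesis by (simp add: levi_carrier_halfspace[OF half_height_add])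
qed

lemma nilradical_half: "nilradical (P_half s) = osp_on (\<lambda>i j. in_half s i \<and> \<not> in_half s j)"
proof -
  have "half_height s (wt j) < half_height s (wt i) \<longleftrightarrow> in_half s i \<and> \<not> in_half s j" for i j
    by (auto simp: half_height_wt choice_sign_def)
  then show ?thesis by (simp add: nilradical_halfspace[OF half_height_add])
qed

definition half_block ::
  "(unit + 'n::finite \<Rightarrow> bool) \<Rightarrow> 'n osp_matrix \<Rightarrow> complex^(unit + 'n)^(unit + 'n)" where
  "half_block s X = (\<chi> a b. X $ half_index s a $ half_index s b)"

text \<open>The block on the chosen half determines the block on the dual half, by membership in \<open>osp(2|2n)\<close>.\<close>

definition half_block_inverse ::
  "(unit + 'n::finite \<Rightarrow> bool) \<Rightarrow> complex^(unit + 'n)^(unit + 'n) \<Rightarrow> 'n osp_matrix" where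
  "half_block_inverse s M = (\<chi> i j.
     if in_half s i \<and> in_half s j then M $ slot i $ slot j
     else if \<not> in_half s i \<and> \<not> in_half s j then swap_sign j i * M $ slot j $ slot i
     else 0)"

lemma half_block_inverse_in_levi: "half_block_inverse s M \<in> levi_carrier (P_half s)"
  unfolding levi_carrier_half
proof (rule osp_onI)
  show "half_block_inverse s M \<in> osp"
    unfolding osp_iff
  proof (intro allI)
    fix i j
    show "half_block_inverse s M $ j $ i =
        swap_sign i j * half_block_inverse s M $ dual i $ dual j"
      using swap_sign_cancel[of i j]
      by (cases "in_half s i"; cases "in_half s j")
         (simp_all add: half_block_inverse_def mult.assoc[symmetric] del: swap_sign_cancel)
  qed
qed (auto simp: half_block_inverse_def split: if_splits)

lemma half_block_half_block_inverse [simp]: "half_block s (half_block_inverse s M) = M"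
  by (simp add: half_block_def half_block_inverse_def vec_eq_iff)

lemma half_block_inverse_half_block:
  assumes "X \<in> levi_carrier (P_half s)"
  shows "half_block_inverse s (half_block s X) = X"
proof -
  have X: "X \<in> osp_on (\<lambda>i j. in_half s i = in_half s j)"
    using assms by (simp add: levi_carrier_half)
  have "half_block_inverse s (half_block s X) $ i $ j = X $ i $ j" for i j
    using osp_onD(2)[OF X, of i j] ospD[OF osp_onD(1)[OF X], of i j]
    by (cases "in_half s i"; cases "in_half s j") (simp_all add: half_block_def half_block_inverse_def)
  then show ?thesis by (simp add: vec_eq_iff)
qed

text \<open>The Levi subalgebra is block diagonal, so restricting to one block is multiplicative.\<close>

lemma half_block_bracket:
  assumes "X \<in> levi_carrier (P_half s)" "Y \<in> levi_carrier (P_half s)"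
  shows "half_block s (super_bracket par X Y) = super_bracket par (half_block s X) (half_block s Y)"
proof -
  have "X $ half_index s a $ dual (half_index s b) = 0" "Y $ half_index s a $ dual (half_index s b) = 0" for a b
    using assms osp_onD(2)[of _ "\<lambda>i j. in_half s i = in_half s j" "half_index s a" "dual (half_index s b)"]
    unfolding levi_carrier_half by auto
  then show ?thesis
    by (simp add: half_block_def vec_eq_iff super_bracket_nth sum_half[where s = s])
qed

lemma half_block_add: "half_block s (X + Y) = half_block s X + half_block s Y"
  by (simp add: half_block_def vec_eq_iff)

lemma levi_half_iso: "lie_superalgebra_iso (levi (P_half s)) gl_1n (half_block s)"
  unfolding lie_superalgebra_iso_def
proof (intro conjI ballI)
  show "superspace_iso (levi (P_half s)) gl_1n (half_block s)"
  proof (rule superspace_isoI[where g = "half_block_inverse s"])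
    show "half_block_inverse s (x + y) = half_block_inverse s x + half_block_inverse s y" for x y
      by (simp add: half_block_inverse_def vec_eq_iff distrib_left)
    show "half_block s (scl (levi (P_half s)) c x) = scl gl_1n c (half_block s x)" for c x
      by (simp add: levi_eq gl_1n_def matrix_superalgebra_def half_block_def vec_eq_iff)
    fix d
    show "half_block s x \<in> homog gl_1n d" if "x \<in> homog (levi (P_half s)) d" for x
      using that homog_matricesD[of x par d "half_index s a" "half_index s b" for a b]
      unfolding levi_eq gl_1n_def matrix_superalgebra_def superspace.simps
      by (auto simp: homog_matrices_def[of _ d] half_block_def)
    show "half_block_inverse s (half_block s x) = x" if "x \<in> homog (levi (P_half s)) d" for x
      using that by (intro half_block_inverse_half_block) (simp add: levi_eq matrix_superalgebra_def)
    show "half_block_inverse s y \<in> homog (levi (P_half s)) d" if "y \<in> homog gl_1n d" for y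
    proof -
      have "y $ a $ b = 0" if "(par a \<noteq> par b) \<noteq> d" for a b
        using that \<open>y \<in> homog gl_1n d\<close> by (auto simp: gl_1n_def matrix_superalgebra_def homog_matrices_def)
      then have "half_block_inverse s y \<in> homog_matrices par d"
        unfolding homog_matrices_def half_block_inverse_def
        by (auto split: if_splits) (metis par_slot)+
      then show ?thesis
        using half_block_inverse_in_levi by (simp add: levi_eq matrix_superalgebra_def)
    qed
  qed (simp_all add: half_block_add)
  show "half_block s (brk (levi (P_half s)) x y) = brk gl_1n (half_block s x) (half_block s y)"
    if "x \<in> whole_space (levi (P_half s))" "y \<in> whole_space (levi (P_half s))" for x y
    using half_block_bracket[of x s y] that whole_space_levi
    by (auto simp: levi_eq gl_1n_def matrix_superalgebra_def)
qed

text \<open>The block of the nilradical has rows in the half and columns in the dual half. Its symmetry involves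
  the values of the form; multiplying each column by minus the value of the form turns it into the
  symmetry of the supersymmetric square of \<open>\<Pi>W\<close>, with its parities reversed.\<close>

definition nil_block ::
  "(unit + 'n::finite \<Rightarrow> bool) \<Rightarrow> 'n osp_matrix \<Rightarrow> complex^(unit + 'n)^(unit + 'n)" where
  "nil_block s X =
     (\<chi> a b. - form_sign (half_index s b) * X $ half_index s a $ dual (half_index s b))"

definition nil_block_inverse ::
  "(unit + 'n::finite \<Rightarrow> bool) \<Rightarrow> complex^(unit + 'n)^(unit + 'n) \<Rightarrow> 'n osp_matrix" where
  "nil_block_inverse s T = (\<chi> i j.
     if in_half s i \<and> \<not> in_half s j then - form_sign (dual j) * T $ slot i $ slot j else 0)"

lemma swap_sign_symmetric:
  "swap_sign i j = koszul (\<not> par j) (\<not> par i) * (form_sign (dual i) * form_sign j)"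
  by (cases "par i"; cases "par j") (simp_all add: swap_sign_def koszul_def form_sign_dual)

lemma nil_block_symmetric:
  assumes "X \<in> osp"
  shows "nil_block s X $ a $ b = koszul (\<not> par a) (\<not> par b) * nil_block s X $ b $ a"
proof -
  define i j where "i = half_index s a" and "j = half_index s b"
  have "X $ i $ dual j = swap_sign (dual j) i * X $ j $ dual i"
    using ospD[OF assms, of i "dual j"] by simp
  also have "swap_sign (dual j) i = koszul (\<not> par a) (\<not> par b) * (form_sign j * form_sign i)"
    by (simp add: swap_sign_symmetric i_def j_def)
  finally have "form_sign j * X $ i $ dual j =
      (form_sign j * form_sign j) * (koszul (\<not> par a) (\<not> par b) * (form_sign i * X $ j $ dual i))"
    by (simp only: mult_ac)
  then show ?thesis by (simp add: nil_block_def i_def j_def)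
qed

lemma nil_block_inverse_in_nilradical:
  assumes T: "\<And>a b. T $ a $ b = koszul (\<not> par a) (\<not> par b) * T $ b $ a"
  shows "nil_block_inverse s T \<in> nilradical (P_half s)"
  unfolding nilradical_half
proof (rule osp_onI)
  show "nil_block_inverse s T \<in> osp"
    unfolding osp_iff
  proof (intro allI)
    fix i j
    show "nil_block_inverse s T $ j $ i = swap_sign i j * nil_block_inverse s T $ dual i $ dual j"
    proof (cases "in_half s j \<and> \<not> in_half s i")
      case True
      have "T $ slot j $ slot i = koszul (\<not> par j) (\<not> par i) * T $ slot i $ slot j"
        using T[of "slot j" "slot i"] by simp
      moreover have "swap_sign i j * form_sign j
         = koszul (\<not> par j) (\<not> par i) * form_sign (dual i) * (form_sign j * form_sign j)"
        by (simp only: swap_sign_symmetric mult_ac)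
      ultimately show ?thesis
        using True by (simp add: nil_block_inverse_def mult.assoc[symmetric])
    qed (auto simp: nil_block_inverse_def)
  qed
qed (auto simp: nil_block_inverse_def split: if_splits)

lemma nil_block_nil_block_inverse: "nil_block s (nil_block_inverse s T) = T"
  by (simp add: nil_block_def nil_block_inverse_def vec_eq_iff mult.assoc[symmetric])

lemma nil_block_inverse_nil_block:
  assumes "X \<in> nilradical (P_half s)"
  shows "nil_block_inverse s (nil_block s X) = X"
  using assms unfolding nilradical_half
  by (auto simp: nil_block_def nil_block_inverse_def vec_eq_iff mult.assoc[symmetric] dest: osp_onD(2))

text \<open>Left multiplication by \<open>Y\<close> acts on the first tensor factor. Right multiplication uses the block of \<open>Y\<close>
  on the dual half; rewritten in terms of the block on the half, it becomes the action on the second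
  factor, and the column signs of \<open>nil_block\<close> cancel the values of the form.\<close>

lemma nil_block_bracket:
  assumes Y: "Y \<in> levi_carrier (P_half s)" and X: "X \<in> nilradical (P_half s)"
  shows "nil_block s (super_bracket par Y X) = act S2_Pi_V1n (half_block s Y) (nil_block s X)"
proof -
  define U where "U = half_index s"
  have Y0: "Y $ U a $ dual (U b) = 0" for a b
    using osp_onD(2)[OF Y[unfolded levi_carrier_half], of "U a" "dual (U b)"] by (simp add: U_def)
  have X0: "X $ U a $ U b = 0" "X $ dual (U a) $ i = 0" for a b i
    using osp_onD(2)[OF X[unfolded nilradical_half]] by (simp_all add: U_def)
  have Yosp: "Y \<in> osp"
    using Y by (auto simp: levi_carrier_half dest: osp_onD)
  have par: "par (U a) = par a" for a by (simp add: U_def)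
  have summand: "- form_sign (U b) *
      (koszul (par a \<noteq> par c) (par c \<noteq> par b) * (X $ U a $ dual (U c) * Y $ dual (U c) $ dual (U b)))
    = - (koszul (par b \<noteq> par c) (\<not> par a) * Y $ U b $ U c * (- form_sign (U c) * X $ U a $ dual (U c)))"
    for a b c
  proof -
    have "Y $ dual (U c) $ dual (U b) = swap_sign (dual (U b)) (dual (U c)) * Y $ U b $ U c"
      using ospD[OF Yosp, of "dual (U c)" "dual (U b)"] by simp
    moreover have "form_sign (U b) * koszul (par a \<noteq> par c) (par c \<noteq> par b) * swap_sign (dual (U b)) (dual (U c))
       = - (koszul (par a \<noteq> par c) (par c \<noteq> par b) * koszul (par b \<noteq> par c) (par b))
         * form_sign (U c) * (form_sign (U b) * form_sign (U b))"
      by (simp add: swap_sign_def par mult_ac)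
    moreover have "koszul (par a \<noteq> par c) (par c \<noteq> par b) * koszul (par b \<noteq> par c) (par b)
       = koszul (par b \<noteq> par c) (\<not> par a)"
      by (cases "par a"; cases "par b"; cases "par c") (simp_all add: koszul_def)
    ultimately have *: "Y $ dual (U c) $ dual (U b) = w * Y $ U b $ U c"
      "form_sign (U b) * k * w = - z * form_sign (U c)"
      if "w = swap_sign (dual (U b)) (dual (U c))" "k = koszul (par a \<noteq> par c) (par c \<noteq> par b)"
        "z = koszul (par b \<noteq> par c) (\<not> par a)" for w k z
      by (simp_all only: that form_sign_square mult_1_right)
    define w k z where "w = swap_sign (dual (U b)) (dual (U c))"
      and "k = koszul (par a \<noteq> par c) (par c \<noteq> par b)"
      and "z = koszul (par b \<noteq> par c) (\<not> par a)"
    note eqs = *[OF w_def k_def z_def]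
    have "- form_sign (U b) * (k * (X $ U a $ dual (U c) * (w * Y $ U b $ U c)))
        = - (form_sign (U b) * k * w) * (X $ U a $ dual (U c) * Y $ U b $ U c)"
      by (simp add: mult_ac)
    also have "\<dots> = - (z * Y $ U b $ U c * (- form_sign (U c) * X $ U a $ dual (U c)))"
      unfolding eqs(2) by (simp add: mult_ac)
    finally show ?thesis
      unfolding k_def[symmetric] z_def[symmetric] eqs(1) .
  qed
  have "nil_block s (super_bracket par Y X) $ a $ b = act S2_Pi_V1n (half_block s Y) (nil_block s X) $ a $ b" for a b
  proof -
    have "nil_block s (super_bracket par Y X) $ a $ b =
       (\<Sum>c\<in>UNIV. - form_sign (U b) * (Y $ U a $ U c * X $ U c $ dual (U b))) -
       (\<Sum>c\<in>UNIV. - form_sign (U b) *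
         (koszul (par a \<noteq> par c) (par c \<noteq> par b) * (X $ U a $ dual (U c) * Y $ dual (U c) $ dual (U b))))"
      by (simp add: nil_block_def super_bracket_nth sum_half[where s = s] U_def[symmetric] X0 Y0 par
          sum_distrib_left sum_negf sum_subtractf right_diff_distrib)
    also have "\<dots> = (\<Sum>c\<in>UNIV. Y $ U a $ U c * (- form_sign (U b) * X $ U c $ dual (U b))) +
       (\<Sum>c\<in>UNIV. koszul (par b \<noteq> par c) (\<not> par a) * Y $ U b $ U c * (- form_sign (U c) * X $ U a $ dual (U c)))"
      unfolding summand sum_negf by (simp add: mult_ac)
    finally show ?thesis
      by (simp add: S2_Pi_V1n_def sym_square_def nil_block_def half_block_def U_def)
  qed
  then show ?thesis by (simp add: vec_eq_iff)
qed

lemma nilradical_half_iso: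
  "lie_module_iso (levi (P_half s)) (half_block s) (nilradical_module (P_half s)) S2_Pi_V1n (nil_block s)"
  unfolding lie_module_iso_def
proof (intro conjI ballI)
  show "superspace_iso (nilradical_module (P_half s)) S2_Pi_V1n (nil_block s)"
  proof (rule superspace_isoI[where g = "nil_block_inverse s"])
    show "nil_block_inverse s (x + y) = nil_block_inverse s x + nil_block_inverse s y" for x y
      by (simp add: nil_block_inverse_def vec_eq_iff algebra_simps)
    show "nil_block s (x + y) = nil_block s x + nil_block s y" for x y
      by (simp add: nil_block_def vec_eq_iff algebra_simps)
    show "nil_block s (scl (nilradical_module (P_half s)) c x) = scl S2_Pi_V1n c (nil_block s x)" for c x
      by (simp add: nilradical_module_def S2_Pi_V1n_def sym_square_def nil_block_def vec_eq_iff)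
    fix d
    show "nil_block s x \<in> homog S2_Pi_V1n d" if "x \<in> homog (nilradical_module (P_half s)) d" for x
    proof -
      from that have "x \<in> osp" "x \<in> homog_matrices par d"
        by (auto simp: nilradical_module_def nilradical_half dest: osp_onD)
      then have "nil_block s x \<in> homog_matrices (\<lambda>i. \<not> par i) d"
        using homog_matricesD[of x par d "half_index s a" "dual (half_index s b)" for a b]
        by (auto simp: homog_matrices_def nil_block_def)
      then show ?thesis
        using nil_block_symmetric[OF \<open>x \<in> osp\<close>, of s]
        unfolding S2_Pi_V1n_def sym_square_def superspace.simps by blast
    qed
    show "nil_block_inverse s (nil_block s x) = x" if "x \<in> homog (nilradical_module (P_half s)) d" for x
      using that by (intro nil_block_inverse_nil_block) (simp add: nilradical_module_def)
    show "nil_block_inverse s y \<in> homog (nilradical_module (P_half s)) d" if "y \<in> homog S2_Pi_V1n d" for y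
    proof -
      have sym: "y $ a $ b = koszul (\<not> par a) (\<not> par b) * y $ b $ a" for a b
        using that unfolding S2_Pi_V1n_def sym_square_def superspace.simps by blast
      have "y $ a $ b = 0" if "(par a \<noteq> par b) \<noteq> d" for a b
      proof -
        have "y \<in> homog_matrices (\<lambda>i. \<not> par i) d"
          using \<open>y \<in> homog S2_Pi_V1n d\<close> unfolding S2_Pi_V1n_def sym_square_def superspace.simps by blast
        from homog_matricesD[OF this, of a b] that show ?thesis by auto
      qed
      then have "nil_block_inverse s y \<in> homog_matrices par d"
        unfolding homog_matrices_def nil_block_inverse_def
        by (auto split: if_splits) (metis par_slot)+
      then show ?thesis
        using nil_block_inverse_in_nilradical[OF sym] by (simp add: nilradical_module_def)
    qed
  qed (simp_all add: nil_block_nil_block_inverse)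
  show "nil_block s (act (nilradical_module (P_half s)) y x) = act S2_Pi_V1n (half_block s y) (nil_block s x)"
    if "y \<in> whole_space (levi (P_half s))" "x \<in> whole_space (nilradical_module (P_half s))" for x y
  proof -
    have "y \<in> levi_carrier (P_half s)" "x \<in> nilradical (P_half s)"
      using that whole_space_levi whole_space_nilradical by blast+
    from nil_block_bracket[OF this] show ?thesis
      by (simp add: nilradical_module_def)
  qed
qed

section \<open>The derived algebra of \<open>gl(1|n)\<close>\<close>

lemma zero_in_derived: "0 \<in> derived_subalgebra A"
  unfolding derived_subalgebra_def by (intro CollectI exI[of _ "0::nat"]) simp

lemma derived_add_bracket:
  assumes "d \<in> derived_subalgebra A" "x \<in> whole_space A" "y \<in> whole_space A"
  shows "d + brk A x y \<in> derived_subalgebra A"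
proof -
  obtain m :: nat and u v where d: "d = (\<Sum>i<m. brk A (u i) (v i))"
    "\<forall>i<m. u i \<in> whole_space A \<and> v i \<in> whole_space A"
    using assms(1) unfolding derived_subalgebra_def by blast
  then have "d + brk A x y = (\<Sum>i<Suc m. brk A ((u(m := x)) i) ((v(m := y)) i))"
    by simp
  moreover have "\<forall>i<Suc m. (u(m := x)) i \<in> whole_space A \<and> (v(m := y)) i \<in> whole_space A"
    using d(2) assms(2,3) by (simp add: less_Suc_eq)
  ultimately show ?thesis
    unfolding derived_subalgebra_def by blast
qed

lemma derived_add_sum:
  assumes "finite I" "\<And>i. i \<in> I \<Longrightarrow> x i \<in> whole_space A" "\<And>i. i \<in> I \<Longrightarrow> y i \<in> whole_space A"
    "d \<in> derived_subalgebra A"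
  shows "d + (\<Sum>i\<in>I. brk A (x i) (y i)) \<in> derived_subalgebra A"
  using assms
proof (induction I rule: finite_induct)
  case (insert a I)
  then have "(d + (\<Sum>i\<in>I. brk A (x i) (y i))) + brk A (x a) (y a) \<in> derived_subalgebra A"
    by (intro derived_add_bracket) auto
  then show ?case using insert by (simp add: algebra_simps)
qed simp

lemma derived_image:
  assumes iso: "lie_superalgebra_iso A B \<phi>" and add: "\<And>x y. \<phi> (x + y) = \<phi> x + \<phi> y"
  shows "\<phi> ` derived_subalgebra A = derived_subalgebra B"
proof -
  have brk: "\<phi> (brk A x y) = brk B (\<phi> x) (\<phi> y)" if "x \<in> whole_space A" "y \<in> whole_space A" for x y
    using iso that unfolding lie_superalgebra_iso_def by blast
  have onto: "\<phi> ` whole_space A = whole_space B"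
    using iso unfolding lie_superalgebra_iso_def superspace_iso_def bij_betw_def by blast
  have sum: "\<phi> (\<Sum>i<m. f i) = (\<Sum>i<m. \<phi> (f i))" for m :: nat and f
    using add[of 0 0] by (induction m) (simp_all add: add)
  show ?thesis
  proof (intro equalityI subsetI)
    fix z assume "z \<in> \<phi> ` derived_subalgebra A"
    then obtain m :: nat and u v where *: "z = \<phi> (\<Sum>i<m. brk A (u i) (v i))"
      "\<forall>i<m. u i \<in> whole_space A \<and> v i \<in> whole_space A"
      unfolding derived_subalgebra_def by blast
    then have "z = (\<Sum>i<m. brk B (\<phi> (u i)) (\<phi> (v i)))"
      by (simp add: sum brk)
    moreover have "\<forall>i<m. \<phi> (u i) \<in> whole_space B \<and> \<phi> (v i) \<in> whole_space B"
      using * onto by blast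
    ultimately show "z \<in> derived_subalgebra B"
      unfolding derived_subalgebra_def
      by (intro CollectI exI[of _ m] exI[of _ "\<lambda>i. \<phi> (u i)"] exI[of _ "\<lambda>i. \<phi> (v i)"] conjI)
  next
    fix z assume "z \<in> derived_subalgebra B"
    then obtain m :: nat and u v where *: "z = (\<Sum>i<m. brk B (u i) (v i))"
      "\<forall>i<m. u i \<in> whole_space B \<and> v i \<in> whole_space B"
      unfolding derived_subalgebra_def by blast
    define r where "r = inv_into (whole_space A) \<phi>"
    have r: "r w \<in> whole_space A \<and> \<phi> (r w) = w" if "w \<in> whole_space B" for w
      using that inv_into_into[of w \<phi> "whole_space A"] f_inv_into_f[of w \<phi> "whole_space A"]
      unfolding onto r_def by blast
    then have "z = \<phi> (\<Sum>i<m. brk A (r (u i)) (r (v i)))"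
      using *(2) by (simp add: sum brk *(1))
    moreover have "(\<Sum>i<m. brk A (r (u i)) (r (v i))) \<in> derived_subalgebra A"
      unfolding derived_subalgebra_def using *(2) r
      by (intro CollectI exI[of _ m] exI[of _ "\<lambda>i. r (u i)"] exI[of _ "\<lambda>i. r (v i)"] conjI refl) simp
    ultimately show "z \<in> \<phi> ` derived_subalgebra A" by blast
  qed
qed

lemma whole_space_matrix_superalgebra:
  assumes add: "\<And>X Y. X \<in> S \<Longrightarrow> Y \<in> S \<Longrightarrow> X + Y \<in> S"
    and mask: "\<And>X d. X \<in> S \<Longrightarrow> mask (\<lambda>i j. (p i \<noteq> p j) = d) X \<in> S"
  shows "whole_space (matrix_superalgebra p S) = S"
proof (intro equalityI subsetI)
  fix X assume "X \<in> whole_space (matrix_superalgebra p S)"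
  then show "X \<in> S" using add by (auto simp: whole_space_def matrix_superalgebra_def)
next
  fix X assume X: "X \<in> S"
  define Y where "Y d = mask (\<lambda>i j. (p i \<noteq> p j) = d) X" for d
  have "Y d \<in> homog (matrix_superalgebra p S) d" for d
    using mask[OF X] by (auto simp: matrix_superalgebra_def Y_def homog_matrices_def)
  moreover have "X = Y False + Y True" by (simp add: Y_def vec_eq_iff)
  ultimately show "X \<in> whole_space (matrix_superalgebra p S)"
    unfolding whole_space_def by blast
qed

lemma supertrace_add: "supertrace p (X + Y) = supertrace p X + supertrace p Y"
  by (simp add: supertrace_def sum.distrib distrib_left)

lemma whole_space_gl_1n: "whole_space gl_1n = UNIV"
  unfolding gl_1n_def by (rule whole_space_matrix_superalgebra) auto

lemma whole_space_sl_1n: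
  "whole_space (sl_1n :: (complex^(unit + 'n::finite)^(unit + 'n)) lie_superalgebra) = {X. supertrace par X = 0}"
  unfolding sl_1n_def
proof (rule whole_space_matrix_superalgebra)
  show "mask (\<lambda>i j. (par i \<noteq> par j) = d) X \<in> {X. supertrace par X = 0}"
    if "X \<in> {X. supertrace par X = 0}" for X :: "complex^(unit + 'n)^(unit + 'n)" and d
    using that by (cases d) (simp_all add: supertrace_def)
qed (simp add: supertrace_add)

text \<open>Exchanging the summation indices in the second product of the bracket turns the sign of row \<open>k\<close> into
  that of row \<open>i\<close>, by means of the Koszul sign.\<close>

lemma supertrace_bracket: "supertrace p (super_bracket p X Y) = 0"
proof -
  define c where "c i k = koszul (p i) (p i) * (X $ i $ k * Y $ k $ i)" for i k
  have swap: "koszul (p i) (p i) * (koszul (p i \<noteq> p k) (p k \<noteq> p i) * (Y $ i $ k * X $ k $ i)) = c k i" for i k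
    by (cases "p i"; cases "p k") (simp_all add: c_def koszul_def)
  have "supertrace p (super_bracket p X Y) = (\<Sum>i\<in>UNIV. \<Sum>k\<in>UNIV. c i k) - (\<Sum>i\<in>UNIV. \<Sum>k\<in>UNIV. c k i)"
    by (simp only: supertrace_def super_bracket_nth sum_distrib_left right_diff_distrib sum_subtractf
        swap c_def[symmetric])
  also have "(\<Sum>i\<in>UNIV. \<Sum>k\<in>UNIV. c k i) = (\<Sum>i\<in>UNIV. \<Sum>k\<in>UNIV. c i k)"
    by (rule sum.swap)
  finally show ?thesis by simp
qed

definition unit_matrix :: "'i \<Rightarrow> 'i \<Rightarrow> complex \<Rightarrow> complex^'i^'i" where
  "unit_matrix a b c = (\<chi> i j. if i = a \<and> j = b then c else 0)"

lemma unit_matrix_product: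
  "(\<Sum>k\<in>UNIV. z k * (unit_matrix a b c $ i $ k * unit_matrix a' b' c' $ k $ j)) =
     (if i = a \<and> b = a' \<and> j = b' then z b * (c * c') else 0)" for i j :: "'i::finite"
proof -
  have "z k * (unit_matrix a b c $ i $ k * unit_matrix a' b' c' $ k $ j) =
     (if k = b then (if i = a \<and> b = a' \<and> j = b' then z b * (c * c') else 0) else 0)" for k
    by (auto simp: unit_matrix_def)
  then show ?thesis by simp
qed

lemma unit_matrix_bracket:
  "super_bracket p (unit_matrix a b c) (unit_matrix a' b' c') $ i $ j =
     (if i = a \<and> b = a' \<and> j = b' then c * c' else 0) -
     (if i = a' \<and> b' = a \<and> j = b then koszul (p i \<noteq> p a) (p a \<noteq> p j) * (c * c') else 0)"
  using unit_matrix_product[of "\<lambda>_. 1" a b c i a' b' c' j]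
    unit_matrix_product[of "\<lambda>k. koszul (p i \<noteq> p k) (p k \<noteq> p j)" a' b' c' i a b c j]
  by (auto simp: super_bracket_nth sum_subtractf)

text \<open>A matrix of supertrace zero is a sum of off-diagonal matrix units, each being an eigenvector of a
  diagonal one, and of multiples of \<open>E\<^sub>0\<^sub>0 + E\<^sub>k\<^sub>k\<close>, the bracket of the odd matrix units \<open>E\<^sub>0\<^sub>k\<close> and
  \<open>E\<^sub>k\<^sub>0\<close>.\<close>

lemma derived_gl_1n:
  "derived_subalgebra (gl_1n :: (complex^(unit + 'n::finite)^(unit + 'n)) lie_superalgebra) = whole_space sl_1n"
proof (intro equalityI subsetI)
  fix X :: "complex^(unit + 'n)^(unit + 'n)"
  assume "X \<in> derived_subalgebra gl_1n"
  then obtain m :: nat and u v where "X = (\<Sum>i<m. super_bracket par (u i) (v i))"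
    unfolding derived_subalgebra_def by (auto simp: gl_1n_def matrix_superalgebra_def)
  moreover have "supertrace par (\<Sum>i<m. super_bracket par (u i) (v i)) = 0"
    for m :: nat and u v :: "nat \<Rightarrow> complex^(unit + 'n)^(unit + 'n)"
  proof (induction m)
    case 0
    then show ?case by (simp add: supertrace_def)
  qed (simp add: supertrace_add supertrace_bracket)
  ultimately show "X \<in> whole_space sl_1n" by (simp add: whole_space_sl_1n)
next
  fix X :: "complex^(unit + 'n)^(unit + 'n)"
  assume "X \<in> whole_space sl_1n"
  then have "supertrace par X = 0" by (simp add: whole_space_sl_1n)
  then have tr: "X $ Inl () $ Inl () = (\<Sum>k\<in>UNIV. X $ Inr k $ Inr k)"
    by (simp add: supertrace_def koszul_def UNIV_Plus_UNIV[symmetric] sum.Plus sum_negf UNIV_unit del: UNIV_Plus_UNIV)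
  define B where "B = brk (gl_1n :: (complex^(unit + 'n)^(unit + 'n)) lie_superalgebra)"
  have B: "B = super_bracket par" by (simp add: B_def gl_1n_def matrix_superalgebra_def)
  define I :: "((unit + 'n) \<times> (unit + 'n)) set" where "I = {(a, b). a \<noteq> b}"
  define off where "off = (\<Sum>ab\<in>I. B (unit_matrix (fst ab) (fst ab) 1) (unit_matrix (fst ab) (snd ab) (X $ fst ab $ snd ab)))"
  define diag where "diag = (\<Sum>k\<in>UNIV. B (unit_matrix (Inl ()) (Inr k) 1) (unit_matrix (Inr k) (Inl ()) (X $ Inr k $ Inr k)))"
  have "0 + off \<in> derived_subalgebra gl_1n"
    unfolding off_def B_def by (rule derived_add_sum) (auto simp: whole_space_gl_1n zero_in_derived)
  then have "0 + off + diag \<in> derived_subalgebra gl_1n"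
    unfolding diag_def B_def by (intro derived_add_sum) (auto simp: whole_space_gl_1n)
  moreover have "X $ i $ j = off $ i $ j + diag $ i $ j" for i j
  proof -
    have "off $ i $ j = (\<Sum>ab\<in>I. if ab = (i, j) then X $ i $ j else 0)"
      unfolding off_def B sum_component by (rule sum.cong) (auto simp: unit_matrix_bracket I_def)
    also have "\<dots> = (if i \<noteq> j then X $ i $ j else 0)"
      by (simp add: sum.delta' I_def)
    finally have 1: "off $ i $ j = (if i \<noteq> j then X $ i $ j else 0)" .
    have d: "diag $ i $ j = (\<Sum>k\<in>UNIV. (if i = Inl () \<and> j = Inl () then X $ Inr k $ Inr k else 0)
        + (if i = Inr k \<and> j = i then X $ Inr k $ Inr k else 0))"
      unfolding diag_def B sum_component by (rule sum.cong) (auto simp: unit_matrix_bracket koszul_def par_def)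
    have 2: "diag $ i $ j = (if i = j then X $ i $ j else 0)"
      unfolding d by (cases i; cases j) (auto simp: tr sum.delta)
    show ?thesis using 1 2 by simp
  qed
  ultimately show "X \<in> derived_subalgebra gl_1n"
    by (metis (no_types, lifting) add_0 vec_eq_iff vector_add_component)
qed

lemma derived_levi_half: "half_block s ` derived_subalgebra (levi (P_half s)) = whole_space sl_1n"
  using derived_image[OF levi_half_iso half_block_add] by (simp add: derived_gl_1n)

section \<open>The Levi subalgebra and nilradical attached to \<open>\<plusminus>\<epsilon>\<^sub>1\<close>\<close>

fun flip :: "'n \<times> bool \<Rightarrow> 'n \<times> bool" where
  "flip (k, s) = (k, \<not> s)"

lemma dual_Inr: "dual (Inr p) = Inr (flip p)"
  by (cases p) simp

lemma sum_osp_index: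
  "(\<Sum>i\<in>UNIV. f i) = f (Inl b) + f (Inl (\<not> b)) + (\<Sum>p\<in>UNIV. f (Inr p))"
  for f :: "'n::finite osp_index \<Rightarrow> complex"
  by (cases b) (simp_all add: UNIV_Plus_UNIV[symmetric] sum.Plus UNIV_bool add_ac del: UNIV_Plus_UNIV)

definition pole_levi :: "bool \<Rightarrow> 'n::finite osp_matrix \<Rightarrow> (complex^('n \<times> bool)^('n \<times> bool)) \<times> complex" where
  "pole_levi b X = ((\<chi> p q. X $ Inr p $ Inr q), X $ Inl b $ Inl b)"

text \<open>The even part of \<open>osp(2|2n)\<close> acts on the two even basis vectors by opposite scalars; only the one at
  \<open>Inl b\<close> is recorded by \<open>pole_levi\<close>. This choice makes \<open>\<complex>\<close> act by \<open>+1\<close> on the nilradical for both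
  values of \<open>b\<close>.\<close>

definition pole_levi_inverse ::
  "bool \<Rightarrow> (complex^('n \<times> bool)^('n \<times> bool)) \<times> complex \<Rightarrow> 'n::finite osp_matrix" where
  "pole_levi_inverse b Z = (\<chi> i j. case i of
     Inl s \<Rightarrow> if j = Inl s then (if s = b then snd Z else - snd Z) else 0
   | Inr p \<Rightarrow> (case j of Inl _ \<Rightarrow> 0 | Inr q \<Rightarrow> fst Z $ p $ q))"

definition pole_nil :: "bool \<Rightarrow> 'n::finite osp_matrix \<Rightarrow> complex^('n \<times> bool)" where
  "pole_nil b X = (\<chi> p. X $ Inr p $ Inl (\<not> b))"

text \<open>The row at \<open>Inl b\<close> repeats the column at \<open>Inl (\<not> b)\<close>, as membership in \<open>osp(2|2n)\<close> forces.\<close>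

definition pole_nil_inverse :: "bool \<Rightarrow> complex^('n \<times> bool) \<Rightarrow> 'n::finite osp_matrix" where
  "pole_nil_inverse b v = (\<chi> i j. case (i, j) of
     (Inr p, Inl s) \<Rightarrow> if s \<noteq> b then v $ p else 0
   | (Inl s, Inr q) \<Rightarrow> if s = b then swap_sign j i * v $ flip q else 0
   | _ \<Rightarrow> 0)"

definition sp_matrices :: "(complex^('n::finite \<times> bool)^('n \<times> bool)) set" where
  "sp_matrices = {M. \<forall>p q. M $ q $ p = swap_sign (Inr p) (Inr q) * M $ flip p $ flip q}"

lemma flip_flip [simp]: "flip (flip p) = p"
  by (cases p) simp

lemma sp_matrices_eq:
  "sp_matrices = {X. transpose X ** (\<chi> i j. symplectic_form i j) + (\<chi> i j. symplectic_form i j) ** X = 0}"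
proof (rule set_eqI)
  fix M :: "complex^('n::finite \<times> bool)^('n \<times> bool)"
  define X where "X = pole_levi_inverse True (M, 0)"
  have X: "X $ Inr p $ Inr q = M $ p $ q" for p q
    by (simp add: X_def pole_levi_inverse_def)
  have J: "symplectic_form p q = (if p = flip q then form_sign (Inr q) else 0)" for p q :: "'n \<times> bool"
    using osp_form_eq[of "Inr p" "Inr q"] by (simp add: dual_Inr)
  have J': "symplectic_form p q = (if q = flip p then form_sign (Inr (flip p)) else 0)" for p q :: "'n \<times> bool"
    unfolding J by auto
  have entry: "(transpose M ** (\<chi> i j. symplectic_form i j) + (\<chi> i j. symplectic_form i j) ** M) $ p $ q = 0
    \<longleftrightarrow> M $ flip q $ p = swap_sign (Inr p) (Inr (flip q)) * M $ flip p $ q" for p q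
  proof -
    have 1: "(\<Sum>k\<in>UNIV. M $ k $ p * symplectic_form k q) = M $ flip q $ p * form_sign (Inr q)"
      by (simp add: J if_distrib[of "\<lambda>x. _ * x"] sum.delta cong: if_cong)
    have 2: "(\<Sum>k\<in>UNIV. symplectic_form p k * M $ k $ q) = form_sign (Inr (flip p)) * M $ flip p $ q"
      by (simp add: J' if_distrib[of "\<lambda>x. x * _"] sum.delta cong: if_cong)
    have k: "koszul False True = 1" by (simp add: koszul_def)
    show ?thesis
      using swap_sign_form[of X "Inr q" "Inr p"]
      by (simp add: matrix_matrix_mult_def transpose_def 1 2 dual_Inr X k)
  qed
  have "M \<in> sp_matrices \<longleftrightarrow> (\<forall>p q. M $ flip q $ p = swap_sign (Inr p) (Inr (flip q)) * M $ flip p $ q)"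
    unfolding sp_matrices_def mem_Collect_eq by (metis flip_flip)
  also have "\<dots> \<longleftrightarrow> (\<forall>p q. (transpose M ** (\<chi> i j. symplectic_form i j) + (\<chi> i j. symplectic_form i j) ** M) $ p $ q = 0)"
    unfolding entry ..
  finally show "M \<in> sp_matrices \<longleftrightarrow> M \<in> {X. transpose X ** (\<chi> i j. symplectic_form i j) + (\<chi> i j. symplectic_form i j) ** X = 0}"
    by (simp add: vec_eq_iff)
qed

lemma sp_2n_eq: "sp_2n = matrix_superalgebra (\<lambda>_. False) sp_matrices"
  by (simp add: sp_2n_def Let_def sp_matrices_eq)

lemma levi_carrier_pole:
  "levi_carrier (P_pole b) = osp_on (\<lambda>i j. i = j \<or> par i \<and> par j)"
proof -
  have "pole_height b (wt i) = pole_height b (wt j) \<longleftrightarrow> i = j \<or> par i \<and> par j" for i j :: "'a osp_index"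
    unfolding pole_height_wt by (cases i; cases j) (auto simp: choice_sign_def)
  then show ?thesis by (simp add: levi_carrier_halfspace[OF pole_height_add])
qed

lemma nilradical_pole:
  "nilradical (P_pole b) = osp_on (\<lambda>i j. i = Inl b \<and> par j \<or> par i \<and> j = Inl (\<not> b))"
proof -
  have "pole_height b (wt j) < pole_height b (wt i) \<longleftrightarrow>
      i = Inl b \<and> par j \<or> par i \<and> j = Inl (\<not> b) \<or> i = Inl b \<and> j = Inl (\<not> b)" for i j :: "'a osp_index"
    unfolding pole_height_wt by (cases i; cases j) (auto simp: choice_sign_def)
  then show ?thesis
    using osp_isotropic_entry[of _ "Inl b"]
    by (fastforce simp: nilradical_halfspace[OF pole_height_add] osp_on_def)
qed

lemma pole_levi_inverse_in_levi:
  assumes "fst Z \<in> sp_matrices"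
  shows "pole_levi_inverse b Z \<in> levi_carrier (P_pole b)"
  unfolding levi_carrier_pole
proof (rule osp_onI)
  show "pole_levi_inverse b Z \<in> osp"
    unfolding osp_iff
  proof (intro allI)
    fix i j
    show "pole_levi_inverse b Z $ j $ i = swap_sign i j * pole_levi_inverse b Z $ dual i $ dual j"
    proof (cases "par i \<and> par j")
      case True
      then obtain p q where "i = Inr p" "j = Inr q" by (cases i; cases j) auto
      moreover have "fst Z $ q $ p = swap_sign (Inr p) (Inr q) * fst Z $ flip p $ flip q"
        using assms unfolding sp_matrices_def by blast
      ultimately show ?thesis by (simp add: pole_levi_inverse_def dual_Inr)
    next
      case False
      then show ?thesis
        by (cases i; cases j) (auto simp: pole_levi_inverse_def dual_Inr swap_sign_simps)
    qed
  qed
  show "i = j \<or> par i \<and> par j" if "pole_levi_inverse b Z $ i $ j \<noteq> 0" for i j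
    using that by (cases i; cases j) (auto simp: pole_levi_inverse_def split: if_splits)
qed

lemma pole_levi_in_sp: "X \<in> osp \<Longrightarrow> fst (pole_levi b X) \<in> sp_matrices"
  unfolding sp_matrices_def mem_Collect_eq
proof (intro allI)
  fix p q
  assume "X \<in> osp"
  from ospD[OF this, of "Inr q" "Inr p"]
  show "fst (pole_levi b X) $ q $ p = swap_sign (Inr p) (Inr q) * fst (pole_levi b X) $ flip p $ flip q"
    by (simp add: pole_levi_def dual_Inr)
qed

lemma pole_levi_inverse_pole_levi:
  assumes "X \<in> levi_carrier (P_pole b)"
  shows "pole_levi_inverse b (pole_levi b X) = X"
proof -
  have X: "X \<in> osp_on (\<lambda>i j. i = j \<or> par i \<and> par j)"
    using assms by (simp add: levi_carrier_pole)
  have neg: "X $ Inl (\<not> b) $ Inl (\<not> b) = - X $ Inl b $ Inl b"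
    using osp_diagonal[OF osp_onD(1)[OF X], of "Inl b"] by simp
  have "pole_levi_inverse b (pole_levi b X) $ i $ j = X $ i $ j" for i j
    using osp_onD(2)[OF X, of i j] neg
    by (cases i; cases j) (auto simp: pole_levi_def pole_levi_inverse_def)
  then show ?thesis by (simp add: vec_eq_iff)
qed

lemma pole_levi_bracket:
  assumes "X \<in> levi_carrier (P_pole b)" "Y \<in> levi_carrier (P_pole b)"
  shows "pole_levi b (super_bracket par X Y) =
     (super_bracket (\<lambda>_. False) (fst (pole_levi b X)) (fst (pole_levi b Y)), 0)"
proof -
  have zero: "Z $ Inl s $ Inr p = 0" "Z $ Inr p $ Inl s = 0" "Z $ Inl (\<not> s) $ Inl s = 0"
    "Z $ Inl s $ Inl (\<not> s) = 0" if "Z \<in> levi_carrier (P_pole b)" for s p Z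
    using osp_onD(2)[OF that[unfolded levi_carrier_pole]] by auto
  show ?thesis
    by (simp add: zero[OF assms(1)] zero[OF assms(2)] pole_levi_def vec_eq_iff super_bracket_nth sum_osp_index[where b = b] koszul_def)
qed

lemma levi_pole_iso: "lie_superalgebra_iso (levi (P_pole b)) sp_2n_plus_C (pole_levi b)"
  unfolding lie_superalgebra_iso_def
proof (intro conjI ballI)
  note target = sp_2n_plus_C_def lie_direct_sum_def sp_2n_eq abelian_line_def matrix_superalgebra_def
  show "superspace_iso (levi (P_pole b)) sp_2n_plus_C (pole_levi b)"
  proof (rule superspace_isoI[where g = "pole_levi_inverse b"])
    show "pole_levi b (x + y) = pole_levi b x + pole_levi b y" for x y
      by (simp add: pole_levi_def vec_eq_iff)
    show "pole_levi_inverse b (x + y) = pole_levi_inverse b x + pole_levi_inverse b y" for x y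
      by (simp add: pole_levi_inverse_def vec_eq_iff split: sum.split)
    show "pole_levi b (scl (levi (P_pole b)) c x) = scl sp_2n_plus_C c (pole_levi b x)" for c x
      by (simp add: levi_eq target pole_levi_def vec_eq_iff)
    fix d
    show "pole_levi b x \<in> homog sp_2n_plus_C d" if "x \<in> homog (levi (P_pole b)) d" for x
    proof -
      from that have x: "x \<in> levi_carrier (P_pole b)" "x \<in> homog_matrices par d"
        by (auto simp: levi_eq matrix_superalgebra_def)
      then have "fst (pole_levi b x) \<in> sp_matrices"
        by (intro pole_levi_in_sp) (auto simp: levi_carrier_pole dest: osp_onD)
      moreover have "x $ i $ j = 0" if d "par i = par j" for i j
        using homog_matricesD[OF x(2), of i j] that by auto
      ultimately show ?thesis
        by (cases d) (auto simp: target pole_levi_def homog_matrices_def)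
    qed
    show "pole_levi_inverse b (pole_levi b x) = x" if "x \<in> homog (levi (P_pole b)) d" for x
      using that by (intro pole_levi_inverse_pole_levi) (simp add: levi_eq matrix_superalgebra_def)
    show "pole_levi_inverse b y \<in> homog (levi (P_pole b)) d" if y: "y \<in> homog sp_2n_plus_C d" for y
    proof -
      have "fst y \<in> sp_matrices" using y by (auto simp: target)
      moreover have even: "par i = par j \<and> y \<noteq> 0" if "pole_levi_inverse b y $ i $ j \<noteq> 0" for i j
        using that by (cases i; cases j) (auto simp: pole_levi_inverse_def split: if_splits)
      have "\<not> d \<or> y = 0"
        using y by (cases y; cases d) (auto simp: target homog_matrices_def vec_eq_iff zero_prod_def)
      then have "pole_levi_inverse b y \<in> homog_matrices par d"
        unfolding homog_matrices_def using even by blast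
      ultimately show ?thesis
        using pole_levi_inverse_in_levi by (simp add: levi_eq matrix_superalgebra_def)
    qed
    show "pole_levi b (pole_levi_inverse b y) = y" for y
      by (simp add: pole_levi_def pole_levi_inverse_def prod_eq_iff vec_eq_iff)
  qed
  show "pole_levi b (brk (levi (P_pole b)) x y) = brk sp_2n_plus_C (pole_levi b x) (pole_levi b y)"
    if "x \<in> whole_space (levi (P_pole b))" "y \<in> whole_space (levi (P_pole b))" for x y
  proof -
    have "x \<in> levi_carrier (P_pole b)" "y \<in> levi_carrier (P_pole b)"
      using that whole_space_levi by blast+
    from pole_levi_bracket[OF this] show ?thesis
      by (simp add: levi_eq target split: prod.split)
  qed
qed

lemma pole_nil_inverse_in_nilradical: "pole_nil_inverse b v \<in> nilradical (P_pole b)"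
  unfolding nilradical_pole
proof (rule osp_onI)
  show "pole_nil_inverse b v \<in> osp"
    unfolding osp_iff
  proof (intro allI)
    fix i j
    show "pole_nil_inverse b v $ j $ i = swap_sign i j * pole_nil_inverse b v $ dual i $ dual j"
      using swap_sign_cancel[of i j]
      by (cases i; cases j)
         (auto simp: pole_nil_inverse_def dual_Inr mult.assoc[symmetric] simp del: swap_sign_cancel)
  qed
  show "i = Inl b \<and> par j \<or> par i \<and> j = Inl (\<not> b)" if "pole_nil_inverse b v $ i $ j \<noteq> 0" for i j
    using that by (cases i; cases j) (auto simp: pole_nil_inverse_def split: if_splits)
qed

lemma pole_nil_inverse_pole_nil:
  assumes "X \<in> nilradical (P_pole b)"
  shows "pole_nil_inverse b (pole_nil b X) = X"
proof -
  have X: "X \<in> osp_on (\<lambda>i j. i = Inl b \<and> par j \<or> par i \<and> j = Inl (\<not> b))"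
    using assms by (simp add: nilradical_pole)
  have "pole_nil_inverse b (pole_nil b X) $ i $ j = X $ i $ j" for i j
    using osp_onD(2)[OF X, of i j] ospD[OF osp_onD(1)[OF X], of i j]
    by (cases i; cases j) (auto simp: pole_nil_def pole_nil_inverse_def dual_Inr)
  then show ?thesis by (simp add: vec_eq_iff)
qed

text \<open>The column at \<open>Inl (\<not> b)\<close> is multiplied by the symplectic block from the left. From the right it meets
  the scalar at \<open>Inl (\<not> b)\<close>, which is minus the one at \<open>Inl b\<close>.\<close>

lemma pole_nil_bracket:
  assumes "Y \<in> levi_carrier (P_pole b)" "X \<in> nilradical (P_pole b)"
  shows "pole_nil b (super_bracket par Y X) = act (parity_shift V_2n) (pole_levi b Y) (pole_nil b X)"
proof -
  have Y: "Y $ Inl s $ Inr p = 0" "Y $ Inr p $ Inl s = 0" "s \<noteq> t \<Longrightarrow> Y $ Inl s $ Inl t = 0" for s t p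
    using osp_onD(2)[OF assms(1)[unfolded levi_carrier_pole]] by auto
  have neg: "Y $ Inl (\<not> b) $ Inl (\<not> b) = - Y $ Inl b $ Inl b"
    using assms(1) osp_diagonal[of Y "Inl b"] by (auto simp: levi_carrier_pole dest: osp_onD)
  show ?thesis
    by (simp add: pole_nil_def vec_eq_iff super_bracket_nth sum_osp_index[where b = b] Y neg koszul_def
        parity_shift_def V_2n_def pole_levi_def matrix_vector_mult_def mult_ac)
qed

lemma nilradical_pole_iso:
  "lie_module_iso (levi (P_pole b)) (pole_levi b) (nilradical_module (P_pole b)) (parity_shift V_2n) (pole_nil b)"
  unfolding lie_module_iso_def
proof (intro conjI ballI)
  show "superspace_iso (nilradical_module (P_pole b)) (parity_shift V_2n) (pole_nil b)"
  proof (rule superspace_isoI[where g = "pole_nil_inverse b"])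
    show "pole_nil b (x + y) = pole_nil b x + pole_nil b y" for x y
      by (simp add: pole_nil_def vec_eq_iff)
    show "pole_nil_inverse b (x + y) = pole_nil_inverse b x + pole_nil_inverse b y" for x y
      by (simp add: pole_nil_inverse_def vec_eq_iff distrib_left split: sum.split)
    show "pole_nil b (scl (nilradical_module (P_pole b)) c x) = scl (parity_shift V_2n) c (pole_nil b x)" for c x
      by (simp add: nilradical_module_def parity_shift_def V_2n_def pole_nil_def vec_eq_iff)
    fix d
    show "pole_nil b x \<in> homog (parity_shift V_2n) d" if "x \<in> homog (nilradical_module (P_pole b)) d" for x
    proof -
      have "x \<in> homog_matrices par d" using that by (simp add: nilradical_module_def)
      then have "x $ Inr p $ Inl (\<not> b) = 0" if "\<not> d" for p
        using homog_matricesD[of x par d "Inr p" "Inl (\<not> b)"] that by auto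
      then show ?thesis
        by (cases d) (simp_all add: parity_shift_def V_2n_def pole_nil_def vec_eq_iff)
    qed
    show "pole_nil_inverse b (pole_nil b x) = x" if "x \<in> homog (nilradical_module (P_pole b)) d" for x
      using that by (intro pole_nil_inverse_pole_nil) (simp add: nilradical_module_def)
    show "pole_nil_inverse b y \<in> homog (nilradical_module (P_pole b)) d" if y: "y \<in> homog (parity_shift V_2n) d" for y
    proof -
      have odd: "(par i \<noteq> par j) \<and> y \<noteq> 0" if "pole_nil_inverse b y $ i $ j \<noteq> 0" for i j
        using that by (cases i; cases j) (auto simp: pole_nil_inverse_def split: if_splits)
      have "d \<or> y = 0" using y by (cases d) (simp_all add: parity_shift_def V_2n_def)
      then have "pole_nil_inverse b y \<in> homog_matrices par d"
        unfolding homog_matrices_def using odd by blast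
      then show ?thesis
        using pole_nil_inverse_in_nilradical by (simp add: nilradical_module_def)
    qed
    show "pole_nil b (pole_nil_inverse b y) = y" for y
      by (simp add: pole_nil_def pole_nil_inverse_def vec_eq_iff)
  qed
  show "pole_nil b (act (nilradical_module (P_pole b)) y x) = act (parity_shift V_2n) (pole_levi b y) (pole_nil b x)"
    if "y \<in> whole_space (levi (P_pole b))" "x \<in> whole_space (nilradical_module (P_pole b))" for x y
  proof -
    have "y \<in> levi_carrier (P_pole b)" "x \<in> nilradical (P_pole b)"
      using that whole_space_levi whole_space_nilradical by blast+
    from pole_nil_bracket[OF this] show ?thesis
      by (simp add: nilradical_module_def)
  qed
qed

section \<open>The four orbits\<close>

lemma wt_add_mem_halfspace:
  assumes "\<And>\<alpha> \<beta>. h (\<alpha> + \<beta>) = h \<alpha> + h \<beta>"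
  shows "wt i + wt j \<in> halfspace_roots h \<longleftrightarrow> j \<noteq> dual i \<and> (par i \<or> par j) \<and> 0 \<le> h (wt i) + h (wt j)"
  by (auto simp: halfspace_roots_def wt_add_mem_roots assms)

lemma P_pole_inj: "P_pole b = (P_pole c :: 'n::finite weight set) \<longleftrightarrow> b = c"
proof -
  have "wt (Inl b) + wt (Inr p) \<in> P_pole c \<longleftrightarrow> b = c" for p :: "'n \<times> bool" and b c
    by (auto simp: wt_add_mem_halfspace[OF pole_height_add] pole_height_wt choice_sign_def simp del: wt.simps)
  from this[of b undefined b] this[of b undefined c] show ?thesis by auto
qed

text \<open>A long root of negative half height tells them apart: \<open>P_pole b\<close> contains all even roots.\<close>

lemma P_pole_neq_P_half: "P_pole b \<noteq> (P_half s :: 'n::finite weight set)"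
proof -
  fix k :: 'n
  define i :: "'n osp_index" where "i = dual (half_index s (Inr k))"
  have "par i" "\<not> in_half s i" by (simp_all add: i_def par_def)
  then have "wt i + wt i \<in> P_pole b" "wt i + wt i \<notin> P_half s"
    unfolding wt_add_mem_halfspace[OF pole_height_add] wt_add_mem_halfspace[OF half_height_add]
    by (simp_all add: pole_height_wt half_height_wt choice_sign_def)
  then show ?thesis by metis
qed

lemma P_half_eqD:
  assumes "P_half s = (P_half t :: 'n::finite weight set)"
  shows "s (Inl ()) = t (Inl ())"
proof (rule ccontr)
  assume ne: "s (Inl ()) \<noteq> t (Inl ())"
  fix k :: 'n
  define i :: "'n osp_index" where "i = dual (half_index t (Inr k))"
  have i: "par i" "\<not> in_half t i" by (simp_all add: i_def par_def)
  then have "i \<noteq> dual (Inl (s (Inl ())))" by auto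
  then have "wt (Inl (s (Inl ()))) + wt i \<in> P_half s" "wt (Inl (s (Inl ()))) + wt i \<notin> P_half t"
    unfolding wt_add_mem_halfspace[OF half_height_add]
    using i ne by (simp_all add: half_height_wt choice_sign_def)
  then show False using assms by simp
qed

theorem theorem2p10:
  shows
    "weyl_orbit ` {P :: ('n::finite weight) set. cominuscule P} =
       {weyl_orbit P_zero, weyl_orbit (uminus ` P_zero), weyl_orbit P_n, weyl_orbit Pbar_n}
     \<and> \<Union> (weyl_orbit ` {P :: ('n weight) set. cominuscule P}) = {P. cominuscule P}
     \<and> card (weyl_orbit ` {P :: ('n weight) set. cominuscule P}) = 4
     \<and> (\<forall>P :: ('n weight) set. P \<in> weyl_orbit P_zero \<union> weyl_orbit (uminus ` P_zero) \<longrightarrow>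
          (\<exists>\<phi> f. lie_superalgebra_iso (levi P)
                   (sp_2n_plus_C :: ((complex^('n \<times> bool)^('n \<times> bool)) \<times> complex) lie_superalgebra) \<phi>
               \<and> lie_module_iso (levi P) \<phi> (nilradical_module P) (parity_shift V_2n) f))
     \<and> (\<forall>P :: ('n weight) set. P \<in> weyl_orbit P_n \<union> weyl_orbit Pbar_n \<longrightarrow>
          (\<exists>\<phi> f. lie_superalgebra_iso (levi P)
                   (gl_1n :: (complex^(unit + 'n)^(unit + 'n)) lie_superalgebra) \<phi>
               \<and> \<phi> ` derived_subalgebra (levi P) = whole_space sl_1n
               \<and> lie_module_iso (levi P) \<phi> (nilradical_module P) S2_Pi_V1n f))"
proof -
  define H :: "bool \<Rightarrow> 'n weight set set" where "H b = P_half ` {t. t (Inl ()) = b}" for b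
  have orbits: "weyl_orbit P_zero = {P_pole True :: 'n weight set}"
    "weyl_orbit (uminus ` P_zero) = {P_pole False :: 'n weight set}"
    "weyl_orbit P_n = H True" "weyl_orbit Pbar_n = H False"
    unfolding minus_P_zero_eq unfolding P_zero_eq P_n_eq Pbar_n_eq weyl_orbit_P_pole weyl_orbit_P_half H_def
    by simp_all
  have com: "{P :: 'n weight set. cominuscule P} = range P_pole \<union> range P_half"
    by (auto simp: cominuscule_iff)
  have H_mem: "P_half s \<in> H (s (Inl ()))" for s
    by (auto simp: H_def)
  have H_orbit: "weyl_orbit (P_half s) = H (s (Inl ()))" for s :: "unit + 'n \<Rightarrow> bool"
    by (simp add: weyl_orbit_P_half H_def)
  have image: "weyl_orbit ` {P :: 'n weight set. cominuscule P} =
      {{P_pole True}, {P_pole False}, H True, H False}"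
  proof -
    have onto: "range (\<lambda>s :: unit + 'n \<Rightarrow> bool. s (Inl ())) = UNIV"
      by (rule surjI[of _ "\<lambda>b _. b"]) simp
    have "weyl_orbit ` range (P_half :: _ \<Rightarrow> 'n weight set) = H ` range (\<lambda>s :: unit + 'n \<Rightarrow> bool. s (Inl ()))"
      by (simp only: image_image H_orbit)
    then have half: "weyl_orbit ` range (P_half :: _ \<Rightarrow> 'n weight set) = {H True, H False}"
      unfolding onto by (simp add: UNIV_bool insert_commute)
    have pole: "weyl_orbit ` range (P_pole :: _ \<Rightarrow> 'n weight set) = {{P_pole True}, {P_pole False}}"
      by (simp add: image_image weyl_orbit_P_pole UNIV_bool insert_commute)
    show ?thesis
      unfolding com image_Un half pole by blast
  qed
  have "P_half (\<lambda>_. True) \<notin> H False"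
    unfolding H_def by (auto dest: P_half_eqD)
  then have "H True \<noteq> H False"
    using H_mem[of "\<lambda>_. True"] by auto
  moreover have "H b \<noteq> {P_pole c}" "{P_pole c} \<noteq> H b" for b c
    using H_mem[of "\<lambda>_. b"] P_pole_neq_P_half[of c "\<lambda>_. b"] by auto
  moreover have "{P_pole True} \<noteq> {P_pole False :: 'n weight set}"
    using P_pole_inj by blast
  ultimately have "card {{P_pole True}, {P_pole False}, H True, H False} = 4"
    by simp
  moreover have "\<Union> {{P_pole True}, {P_pole False}, H True, H False} = {P. cominuscule P}"
  proof -
    have "H True \<union> H False = range P_half" unfolding H_def by blast
    moreover have "{P_pole True} \<union> {P_pole False} = (range P_pole :: 'n weight set set)"
      by (auto simp: UNIV_bool)
    ultimately show ?thesis unfolding com by auto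
  qed
  moreover have "\<exists>\<phi> f. lie_superalgebra_iso (levi P)
        (sp_2n_plus_C :: ((complex^('n \<times> bool)^('n \<times> bool)) \<times> complex) lie_superalgebra) \<phi>
      \<and> lie_module_iso (levi P) \<phi> (nilradical_module P) (parity_shift V_2n) f"
    if "P = P_pole b" for P :: "'n weight set" and b
    unfolding that using levi_pole_iso nilradical_pole_iso by blast
  moreover have "\<exists>\<phi> f. lie_superalgebra_iso (levi P)
        (gl_1n :: (complex^(unit + 'n)^(unit + 'n)) lie_superalgebra) \<phi>
      \<and> \<phi> ` derived_subalgebra (levi P) = whole_space sl_1n
      \<and> lie_module_iso (levi P) \<phi> (nilradical_module P) S2_Pi_V1n f"
    if "P = P_half s" for P :: "'n weight set" and s
    unfolding that using levi_half_iso nilradical_half_iso derived_levi_half by blast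
  ultimately show ?thesis
    unfolding orbits image H_def by blast
qed

end
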